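(* Let $\ell,n\in\mathbb N$, $k\in[n]$ and $\gamma\in(0,\frac12]$. Let $N=\ell n$, $K=k\ell$, $p=2q$ and $m_0=\lfloor\log_2(1/\gamma)\rfloor$. Assume that $16q\ell^2\le1$ and $k\ge6e\ell$. Let $\widetilde G$ be the random graph on $[N]$ obtained from a graph $G$ on $[n]$ by the randomized reduction described in the context. If $G\sim\mathcal G(n,\gamma)$, then $\widetilde G\sim\mathcal G(N,q)$. If $G\sim\mathcal G(n,k,\gamma)$ (the planted clique model), then the law $P_{\widetilde G|H_1^{\rm C}}$ of $\widetilde G$ satisfies $$d_{\rm TV}\left(P_{\widetilde G|H_1^{\rm C}},\mathbb P_1\right)\le e^{-\frac K{12}}+1.5\,k\,e^{-\frac\ell{18}}+2k^2(8q\ell^2)^{m_0+1}+0.5\sqrt{e^{72e^2q\ell^2}-1}+\sqrt{0.5k}\,e^{-\frac\ell{36}},$$ where $\mathbb P_1$ is the law of $\mathcal G(N,K,p,q)$.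
   Context: Models. $\mathcal G(N,q)$ is the Erdős–Rényi random graph on $N$ vertices with edge probability $q$. $\mathcal G(n,k,\gamma)$ is the planted clique model: draw a graph from $\mathcal G(n,\gamma)$, choose $k$ vertices uniformly at random, and add all edges among them. $\mathcal G(N,K,p,q)$ (with $p>q$) is the planted dense subgraph model on $N$ vertices: each vertex is included in a random set $S$ independently with probability $K/N$; given $S$, each pair of vertices is connected independently, with probability $p$ if both vertices are in $S$ and with probability $q$ otherwise. $d_{\rm TV}$ is the total variation distance and $[n]=\{1,\dots,n\}$. Reduction $G\mapsto\widetilde G$. Let $A$ be the adjacency matrix of $G$. Each vertex of $[N]$ is assigned a parent in $[n]$, independently and uniformly at random (and independently of $G$). Let $V_s$ be the set of vertices of $[N]$ with parent $s\in[n]$ and $\ell_s=|V_s|$. For $1\le s<t\le n$ let $P_{\ell_s\ell_t}$ and $Q_{\ell_s\ell_t}$ be the probability mass functions of $\mathrm{Binom}(\ell_s\ell_t,p)$ and $\mathrm{Binom}(\ell_s\ell_t,q)$, and define on $\{0,\dots,\ell_s\ell_t\}$ $$P'_{\ell_s\ell_t}(m)=\begin{cases}P_{\ell_s\ell_t}(m)+a_{\ell_s\ell_t}& m=0,\\ P_{\ell_s\ell_t}(m)&1\le m\le m_0,\\ \frac1\gamma Q_{\ell_s\ell_t}(m)& m_0<m\le\ell_s\ell_t,\end{cases}\qquad a_{\ell_s\ell_t}=\sum_{m_0<m\le\ell_s\ell_t}\left[P_{\ell_s\ell_t}(m)-\tfrac1\gamma Q_{\ell_s\ell_t}(m)\right],$$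 and $Q'_{\ell_s\ell_t}=\frac1{1-\gamma}\left(Q_{\ell_s\ell_t}-\gamma P'_{\ell_s\ell_t}\right)$. (When $\ell_s,\ell_t\le2\ell$ and $16q\ell^2\le1$ these are probability distributions.) Conditionally on $A$ and $\{V_s\}$, the edge counts $E(V_s,V_t)$, $1\le s\le t\le n$, are drawn independently: $E(V_s,V_s)\sim\mathrm{Binom}(\binom{\ell_s}{2},q)$, and for $s<t$, $E(V_s,V_t)\sim P'_{\ell_s\ell_t}$ if $A_{st}=1$ and $\ell_s,\ell_t\le2\ell$; $E(V_s,V_t)\sim Q'_{\ell_s\ell_t}$ if $A_{st}=0$ and $\ell_s,\ell_t\le2\ell$; $E(V_s,V_t)\sim Q_{\ell_s\ell_t}$ if $\max\{\ell_s,\ell_t\}>2\ell$. Given the counts, independently for each $s\le t$, the set of edges of $\widetilde G$ between $V_s$ and $V_t$ (within $V_s$ if $s=t$) is chosen uniformly at random among all sets of $E(V_s,V_t)$ such pairs. *)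

theory Defs
  imports "HOL-Probability.Probability" "HOL-Library.Ramsey"
begin

text \<open>
  A simple graph on a vertex set \<open>V\<close> is represented by its edge set, a subset of
  the set \<open>[V]\<^bsup>2\<^esup>\<close> of two-element subsets of \<open>V\<close>; random graphs are
  \<open>pmf\<close>s over edge sets.
\<close>

type_synonym graph = "nat set set"

definition indep_edges_pmf :: "nat set \<Rightarrow> (nat set \<Rightarrow> real) \<Rightarrow> graph pmf" where
  "indep_edges_pmf V r =
     map_pmf (\<lambda>x. {e \<in> [V]\<^bsup>2\<^esup>. x e}) (Pi_pmf ([V]\<^bsup>2\<^esup>) False (\<lambda>e. bernoulli_pmf (r e)))"

definition erdos_renyi :: "nat \<Rightarrow> real \<Rightarrow> graph pmf" where
  "erdos_renyi N q = indep_edges_pmf {1..N} (\<lambda>_. q)"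

definition planted_clique :: "nat \<Rightarrow> nat \<Rightarrow> real \<Rightarrow> graph pmf" where
  "planted_clique n k \<gamma> =
     do {
       G \<leftarrow> erdos_renyi n \<gamma>;
       S \<leftarrow> pmf_of_set ([{1..n}]\<^bsup>k\<^esup>);
       return_pmf (G \<union> [S]\<^bsup>2\<^esup>)
     }"

definition planted_dense_subgraph :: "nat \<Rightarrow> nat \<Rightarrow> real \<Rightarrow> real \<Rightarrow> graph pmf" where
  "planted_dense_subgraph N K p q =
     do {
       x \<leftarrow> Pi_pmf {1..N} False (\<lambda>_. bernoulli_pmf (real K / real N));
       let S = {v \<in> {1..N}. x v};
       indep_edges_pmf {1..N} (\<lambda>e. if e \<subseteq> S then p else q)
     }"

definition total_variation :: "'a pmf \<Rightarrow> 'a pmf \<Rightarrow> real" where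
  "total_variation P Q = (SUP A. \<bar>measure_pmf.prob P A - measure_pmf.prob Q A\<bar>)"

text \<open>
  The mass functions \<open>P'\<close> and \<open>Q'\<close> for \<open>M = \<ell>\<^sub>s \<ell>\<^sub>t\<close> possible edges. They vanish for
  \<open>m > M\<close>, since the binomial mass functions do.
\<close>

definition excess_mass :: "real \<Rightarrow> nat \<Rightarrow> real \<Rightarrow> real \<Rightarrow> nat \<Rightarrow> real" where
  "excess_mass \<gamma> m0 p q M =
     (\<Sum>m\<in>{m0<..M}. pmf (binomial_pmf M p) m - 1 / \<gamma> * pmf (binomial_pmf M q) m)"

definition P'_mass :: "real \<Rightarrow> nat \<Rightarrow> real \<Rightarrow> real \<Rightarrow> nat \<Rightarrow> nat \<Rightarrow> real" where
  "P'_mass \<gamma> m0 p q M m =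
     (if m = 0 then pmf (binomial_pmf M p) m + excess_mass \<gamma> m0 p q M
      else if m \<le> m0 then pmf (binomial_pmf M p) m
      else 1 / \<gamma> * pmf (binomial_pmf M q) m)"

definition Q'_mass :: "real \<Rightarrow> nat \<Rightarrow> real \<Rightarrow> real \<Rightarrow> nat \<Rightarrow> nat \<Rightarrow> real" where
  "Q'_mass \<gamma> m0 p q M m =
     1 / (1 - \<gamma>) * (pmf (binomial_pmf M q) m - \<gamma> * P'_mass \<gamma> m0 p q M m)"

text \<open>
  \<open>embed_pmf\<close> is meaningful only for genuine mass functions; that it is applied to such
  in the relevant parameter range is shown in \<open>pmf_P'_pmf\<close> and \<open>pmf_Q'_pmf\<close> below.
\<close>

definition P'_pmf :: "real \<Rightarrow> nat \<Rightarrow> real \<Rightarrow> real \<Rightarrow> nat \<Rightarrow> nat pmf" where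
  "P'_pmf \<gamma> m0 p q M = embed_pmf (P'_mass \<gamma> m0 p q M)"

definition Q'_pmf :: "real \<Rightarrow> nat \<Rightarrow> real \<Rightarrow> real \<Rightarrow> nat \<Rightarrow> nat pmf" where
  "Q'_pmf \<gamma> m0 p q M = embed_pmf (Q'_mass \<gamma> m0 p q M)"

text \<open>
  For disjoint \<open>A\<close>, \<open>B\<close> these are the \<open>card A * card B\<close> pairs between them; for \<open>A = B\<close>
  the \<open>card A choose 2\<close> pairs within \<open>A\<close>.
\<close>

definition pairs_between :: "nat set \<Rightarrow> nat set \<Rightarrow> graph" where
  "pairs_between A B = {{u, v} |u v. u \<in> A \<and> v \<in> B \<and> u \<noteq> v}"

definition edge_count_pmf ::
  "nat \<Rightarrow> real \<Rightarrow> nat \<Rightarrow> real \<Rightarrow> real \<Rightarrow> graph \<Rightarrow> (nat \<Rightarrow> nat set) \<Rightarrow> nat \<times> nat \<Rightarrow> nat pmf" where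
  "edge_count_pmf l \<gamma> m0 p q G V = (\<lambda>(s, t).
     if s = t then binomial_pmf (card (V s) choose 2) q
     else if max (card (V s)) (card (V t)) > 2 * l then binomial_pmf (card (V s) * card (V t)) q
     else if {s, t} \<in> G then P'_pmf \<gamma> m0 p q (card (V s) * card (V t))
     else Q'_pmf \<gamma> m0 p q (card (V s) * card (V t)))"

definition clique_reduction ::
  "nat \<Rightarrow> nat \<Rightarrow> nat \<Rightarrow> real \<Rightarrow> nat \<Rightarrow> real \<Rightarrow> real \<Rightarrow> graph \<Rightarrow> graph pmf" where
  "clique_reduction n N l \<gamma> m0 p q G =
     do {
       parent \<leftarrow> Pi_pmf {1..N} 0 (\<lambda>_. pmf_of_set {1..n});
       let V = (\<lambda>s. {v \<in> {1..N}. parent v = s});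
       let I = {(s, t). 1 \<le> s \<and> s \<le> t \<and> t \<le> n};
       E \<leftarrow> Pi_pmf I 0 (edge_count_pmf l \<gamma> m0 p q G V);
       F \<leftarrow> Pi_pmf I {} (\<lambda>(s, t). pmf_of_set ([pairs_between (V s) (V t)]\<^bsup>E (s, t)\<^esup>));
       return_pmf (\<Union>i\<in>I. F i)
     }"

context
  fixes \<gamma> q :: real and l ls lt m0 M :: nat
  assumes \<gamma>: "0 < \<gamma>" "\<gamma> \<le> 1 / 2" and q: "0 < q" and l1: "1 \<le> l"
    and m0: "m0 = nat \<lfloor>log 2 (1 / \<gamma>)\<rfloor>"
    and ql: "16 * q * real l ^ 2 \<le> 1" and l: "ls \<le> 2 * l" "lt \<le> 2 * l"
    and M: "M = ls * lt"
begin

private lemma qM: "q * real M \<le> 1 / 4"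
proof -
  have "M \<le> (2 * l) * (2 * l)"
    unfolding M using l by (rule mult_le_mono)
  then have "real M \<le> real ((2 * l) * (2 * l))"
    by (simp only: of_nat_le_iff)
  then have "q * real M \<le> q * (4 * real l ^ 2)"
    using q by (intro mult_left_mono) (auto simp: power2_eq_square)
  then show ?thesis using ql by simp
qed

private lemma m0_bounds: "1 \<le> m0" "2 ^ m0 \<le> 1 / \<gamma>" "1 / \<gamma> < 2 ^ (m0 + 1)"
proof -
  have "2 \<le> 1 / \<gamma>" using \<gamma> by (simp add: field_simps)
  then have one: "1 \<le> log 2 (1 / \<gamma>)" using \<gamma> by (subst le_log_iff) auto
  then have fl: "\<lfloor>log 2 (1 / \<gamma>)\<rfloor> = int m0" unfolding m0 by simp
  then show "1 \<le> m0" using one by linarith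
  have "real m0 \<le> log 2 (1 / \<gamma>)" "log 2 (1 / \<gamma>) < real (m0 + 1)" using fl by linarith+
  then have "2 powr real m0 \<le> 1 / \<gamma>" "1 / \<gamma> < 2 powr real (m0 + 1)"
    using \<gamma> le_log_iff[of 2 "1 / \<gamma>" "real m0"] log_less_iff[of 2 "1 / \<gamma>" "real (m0 + 1)"] by auto
  then show "2 ^ m0 \<le> 1 / \<gamma>" "1 / \<gamma> < 2 ^ (m0 + 1)"
    by (simp_all only: powr_realpow)
qed

private lemma q_le: "q \<le> 1 / 16"
proof -
  have "1 \<le> real l ^ 2" using l1 by (simp add: one_le_power)
  then have "16 * q * 1 \<le> 16 * q * real l ^ 2" using q by (intro mult_left_mono) auto
  then show ?thesis using ql by simp
qed

private abbreviation "PM \<equiv> pmf (binomial_pmf M (2 * q))"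
private abbreviation "QM \<equiv> pmf (binomial_pmf M q)"
private abbreviation "P' \<equiv> P'_mass \<gamma> m0 (2 * q) q M"
private abbreviation "Q' \<equiv> Q'_mass \<gamma> m0 (2 * q) q M"

private lemma binomial_mass:
  "PM m = real (M choose m) * (2 * q) ^ m * (1 - 2 * q) ^ (M - m)"
  "QM m = real (M choose m) * q ^ m * (1 - q) ^ (M - m)"
  using q q_le by auto

private lemma sum_binomial: "sum PM {..M} = 1" "sum QM {..M} = 1"
  using q q_le by (intro sum_pmf_eq_1; force)+

private lemma sum_P': "sum P' {..M} = 1"
proof -
  have "P' m = PM m + (if m = 0 then excess_mass \<gamma> m0 (2 * q) q M else 0)
          - (if m \<in> {m0<..M} then PM m - 1 / \<gamma> * QM m else 0)" if "m \<le> M" for m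
    using that by (auto simp: P'_mass_def)
  then have "sum P' {..M} = sum PM {..M} + (\<Sum>m\<le>M. if m = 0 then excess_mass \<gamma> m0 (2 * q) q M else 0)
          - (\<Sum>m\<le>M. if m \<in> {m0<..M} then PM m - 1 / \<gamma> * QM m else 0)"
    by (simp only: sum.distrib[symmetric] sum_subtractf[symmetric]) (intro sum.cong, auto)
  also have "(\<Sum>m\<le>M. if m \<in> {m0<..M} then PM m - 1 / \<gamma> * QM m else 0)
      = excess_mass \<gamma> m0 (2 * q) q M"
  proof -
    have "{..M} \<inter> {m0<..M} = {m0<..M}" by auto
    then show ?thesis
      using sum.inter_restrict[of "{..M}" "\<lambda>m. PM m - 1 / \<gamma> * QM m" "{m0<..M}"]
      by (simp add: excess_mass_def)
  qed
  also have "(\<Sum>m\<le>M. if m = 0 then excess_mass \<gamma> m0 (2 * q) q M else 0)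
      = excess_mass \<gamma> m0 (2 * q) q M"
    by simp
  finally show ?thesis using sum_binomial by simp
qed

private lemma QM_tail: "(\<Sum>m\<in>{m0<..M}. 1 / \<gamma> * QM m) \<le> 1 / 2"
proof -
  have bound: "1 / \<gamma> * QM m \<le> (1 / 2) ^ m" if m: "m \<in> {m0<..M}" for m
  proof -
    have "real (M choose m) \<le> real M ^ m"
      using binomial_le_pow[of m M] m by (metis greaterThanAtMost_iff of_nat_le_iff of_nat_power)
    then have "real (M choose m) * q ^ m * (1 - q) ^ (M - m) \<le> real M ^ m * q ^ m * 1"
      using q q_le by (intro mult_mono power_le_one) auto
    also have "\<dots> = (q * real M) ^ m" by (simp add: power_mult_distrib mult.commute)
    also have "\<dots> \<le> (1 / 4) ^ m" using qM q by (intro power_mono) auto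
    finally have 1: "QM m \<le> (1 / 4) ^ m" by (simp only: binomial_mass)
    have "(2::real) ^ (m0 + 1) \<le> 2 ^ m" using m by (intro power_increasing) auto
    then have "1 / \<gamma> \<le> 2 ^ m" using m0_bounds(3) by linarith
    then have "1 / \<gamma> * QM m \<le> 2 ^ m * (1 / 4) ^ m"
      using 1 \<gamma> by (intro mult_mono) auto
    also have "\<dots> = (1 / 2) ^ m" by (simp flip: power_mult_distrib)
    finally show ?thesis .
  qed
  have geo: "(\<Sum>m\<in>{2..j}. (1 / 2) ^ m) \<le> (1 / 2 :: real) - (1 / 2) ^ j" if "1 \<le> j" for j :: nat
    using that by (induction j rule: dec_induct) auto
  have "(\<Sum>m\<in>{m0<..M}. 1 / \<gamma> * QM m) \<le> (\<Sum>m\<in>{m0<..M}. (1 / 2) ^ m)"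
    using bound by (rule sum_mono)
  also have "\<dots> \<le> (\<Sum>m\<in>{2..Suc M}. (1 / 2) ^ m)"
    using m0_bounds(1) by (intro sum_mono2) auto
  also have "\<dots> \<le> 1 / 2 - (1 / 2) ^ Suc M" by (rule geo) simp
  also have "\<dots> \<le> 1 / 2" by simp
  finally show ?thesis .
qed

private lemma P'_nonneg: "0 \<le> P' m"
proof (cases "m = 0")
  case True
  have "1 + real M * (- (2 * q)) \<le> (1 + (- (2 * q))) ^ M"
    using q_le by (intro Bernoulli_inequality) auto
  then have "1 / 2 \<le> PM 0" using qM by (simp only: binomial_mass) (simp add: mult_ac)
  moreover have "excess_mass \<gamma> m0 (2 * q) q M = sum PM {m0<..M} - (\<Sum>m\<in>{m0<..M}. 1 / \<gamma> * QM m)"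
    by (simp only: excess_mass_def sum_subtractf)
  moreover have "0 \<le> sum PM {m0<..M}" by (intro sum_nonneg) (rule pmf_nonneg)
  ultimately have "0 \<le> PM 0 + excess_mass \<gamma> m0 (2 * q) q M"
    using QM_tail by linarith
  then show ?thesis using True unfolding P'_mass_def by presburger
next
  case False
  have "0 \<le> 1 / \<gamma> * QM m" using \<gamma> by (intro mult_nonneg_nonneg pmf_nonneg) auto
  then show ?thesis using False pmf_nonneg[of "binomial_pmf M (2 * q)" m]
    unfolding P'_mass_def by presburger
qed

private lemma Q'_nonneg: "0 \<le> Q' m"
proof -
  have "\<gamma> * P' m \<le> QM m"
  proof -
    consider "m = 0" | "0 < m" "m \<le> m0" | "m > m0" by linarith
    then show ?thesis
    proof cases
      case 1
      have "P' 0 \<le> sum P' {..M}" using P'_nonneg by (intro member_le_sum) auto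
      then have "\<gamma> * P' 0 \<le> 1 / 2 * 1"
        using sum_P' P'_nonneg[of 0] \<gamma> by (intro mult_mono) auto
      moreover have "1 + real M * (- q) \<le> (1 + (- q)) ^ M"
        using q_le by (intro Bernoulli_inequality) auto
      then have "3 / 4 \<le> QM 0" using qM by (simp only: binomial_mass) (simp add: mult_ac)
      ultimately show ?thesis using 1 by simp
    next
      case 2
      have "(2::real) ^ m \<le> 2 ^ m0" using 2 by (intro power_increasing) auto
      then have "2 ^ m \<le> 1 / \<gamma>" using m0_bounds(2) by linarith
      then have g: "\<gamma> * 2 ^ m \<le> 1" using \<gamma> by (simp add: field_simps)
      have "\<gamma> * PM m = (\<gamma> * 2 ^ m) * (real (M choose m) * q ^ m * (1 - 2 * q) ^ (M - m))"
        by (simp only: binomial_mass power_mult_distrib) (simp add: mult_ac)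
      also have "\<dots> \<le> 1 * (real (M choose m) * q ^ m * (1 - q) ^ (M - m))"
        using g q q_le by (intro mult_mono power_mono mult_nonneg_nonneg zero_le_power) auto
      also have "\<dots> = QM m" by (simp only: binomial_mass)
      finally show ?thesis using 2 by (simp add: P'_mass_def)
    next
      case 3
      then show ?thesis using \<gamma> by (simp add: P'_mass_def)
    qed
  qed
  then show ?thesis using \<gamma> unfolding Q'_mass_def by (intro mult_nonneg_nonneg) auto
qed

private lemma sum_Q': "sum Q' {..M} = 1"
proof -
  have "sum Q' {..M} = 1 / (1 - \<gamma>) * (sum QM {..M} - \<gamma> * sum P' {..M})"
    unfolding Q'_mass_def by (simp only: sum_distrib_left[symmetric] sum_subtractf)
  then show ?thesis using \<gamma> by (simp only: sum_P' sum_binomial) simp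
qed

private lemma mass_outside: "m > M \<Longrightarrow> P' m = 0" "m > M \<Longrightarrow> Q' m = 0"
  using q q_le by (auto simp: P'_mass_def Q'_mass_def)

private lemma pmf_embed_finite:
  fixes f :: "nat \<Rightarrow> real"
  assumes "\<And>m. 0 \<le> f m" "sum f {..M} = 1" "\<And>m. m > M \<Longrightarrow> f m = 0"
  shows "pmf (embed_pmf f) = f"
proof -
  have "(\<integral>\<^sup>+m. ennreal (f m) \<partial>count_space UNIV) = (\<Sum>m\<le>M. ennreal (f m))"
    using assms by (intro nn_integral_count_space') (auto simp: not_le)
  also have "\<dots> = 1" using assms by simp
  finally show ?thesis using assms by (intro ext pmf_embed_pmf) auto
qed

lemma pmf_P'_pmf: "pmf (P'_pmf \<gamma> m0 (2 * q) q M) = P'_mass \<gamma> m0 (2 * q) q M"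
  unfolding P'_pmf_def by (intro pmf_embed_finite P'_nonneg sum_P' mass_outside)

lemma pmf_Q'_pmf: "pmf (Q'_pmf \<gamma> m0 (2 * q) q M) = Q'_mass \<gamma> m0 (2 * q) q M"
  unfolding Q'_pmf_def by (intro pmf_embed_finite Q'_nonneg sum_Q' mass_outside)

end

end

theory Submission
  imports Defs
begin

text \<open>
  Mixing \<open>P'\<close> and \<open>Q'\<close> with weights \<open>\<gamma>\<close> and \<open>1 - \<gamma>\<close> gives \<open>Binom(\<cdot>, q)\<close>, and a
  uniform set of binomially many pairs is a set of independent pairs; so every block whose edge of
  the input graph has probability \<open>\<gamma>\<close> becomes a block of independent edges of probability \<open>q\<close>.
  This settles the null hypothesis.

  Under the planted model fix the clique \<open>S\<close>. The set \<open>W\<close> of vertices with parent in \<open>S\<close> is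
  distributed exactly as the planted set of the target, and \<open>|W| < 3 K / 2\<close> up to probability
  \<open>e\<^bsup>-K/12\<^esup>\<close>. Given \<open>W\<close>, the parents on \<open>W\<close> are uniform in \<open>S\<close>, and all fibres have at
  most \<open>2 l\<close> vertices up to probability \<open>\<delta> = k e\<^bsup>-l/18\<^esup>\<close>. On that event \<open>P'\<close> may be replaced by
  \<open>Binom(\<cdot>, p)\<close> block by block. What remains is the mixture over parent maps of the graph with
  edge probability \<open>p\<close> between distinct fibres of \<open>W\<close> and \<open>q\<close> elsewhere, to be compared with
  \<open>p\<close> on all of \<open>W\<close>. The second moment of the likelihood ratio, restricted to small fibres, is
  at most the mean of \<open>(1 + q)\<^bsup>c\<^esup>\<close>, where \<open>c\<close> counts the pairs joined by both of two
  independent parent maps. Exposing the vertices of \<open>W\<close> one by one bounds it by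
  \<open>exp (q |W|\<^sup>2 / k\<^sup>2) \<le> exp (9 q l\<^sup>2 / 4)\<close>.
\<close>

section \<open>Total variation bounds\<close>

text \<open>Nonnegative extended integrals satisfy the tower rule without integrability conditions;
  the bound \<open>B\<close> carries it over to real expectations.\<close>

lemma expectation_bind_pmf_bounded:
  fixes h :: "'b \<Rightarrow> real"
  assumes "\<And>x. 0 \<le> h x" "\<And>x. h x \<le> B"
  shows "measure_pmf.expectation (bind_pmf M f) h
    = measure_pmf.expectation M (\<lambda>x. measure_pmf.expectation (f x) h)"
proof -
  have int: "integrable (measure_pmf P) h" for P :: "'b pmf"
    using assms by (intro measure_pmf.integrable_const_bound[where B=B]) auto
  have bd: "0 \<le> measure_pmf.expectation P h" "measure_pmf.expectation P h \<le> B" for P :: "'b pmf"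
    using assms int by (auto intro!: measure_pmf.integral_le_const)
  have int2: "integrable (measure_pmf M) (\<lambda>x. measure_pmf.expectation (f x) h)"
    using bd by (intro measure_pmf.integrable_const_bound[where B=B]) auto
  have nn: "(\<integral>\<^sup>+x. ennreal (h x) \<partial>measure_pmf P) = ennreal (measure_pmf.expectation P h)" for P :: "'b pmf"
    using int assms by (intro nn_integral_eq_integral) auto
  have "ennreal (measure_pmf.expectation (bind_pmf M f) h) = (\<integral>\<^sup>+x. ennreal (measure_pmf.expectation (f x) h) \<partial>measure_pmf M)"
    by (simp add: nn[symmetric])
  also have "\<dots> = ennreal (measure_pmf.expectation M (\<lambda>x. measure_pmf.expectation (f x) h))"
    using int2 bd by (intro nn_integral_eq_integral) auto
  finally show ?thesis
    using bd by (subst (asm) ennreal_inj) (auto intro!: integral_nonneg_AE)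
qed

text \<open>Test functions instead of events: this form of the bound passes through Markov kernels.\<close>

definition tv_le :: "'a pmf \<Rightarrow> 'a pmf \<Rightarrow> real \<Rightarrow> bool" where
  "tv_le P Q \<epsilon> \<longleftrightarrow> (\<forall>h. (\<forall>x. 0 \<le> h x \<and> h x \<le> 1) \<longrightarrow>
     measure_pmf.expectation P h - measure_pmf.expectation Q h \<le> \<epsilon>)"

lemma tv_leD:
  "tv_le P Q \<epsilon> \<Longrightarrow> (\<And>x. 0 \<le> h x) \<Longrightarrow> (\<And>x. h x \<le> 1) \<Longrightarrow>
    measure_pmf.expectation P h - measure_pmf.expectation Q h \<le> \<epsilon>"
  by (auto simp: tv_le_def)

lemma expectation_unit_interval:
  fixes h :: "'a \<Rightarrow> real"
  assumes "\<And>x. 0 \<le> h x" "\<And>x. h x \<le> 1"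
  shows "integrable (measure_pmf P) h" "0 \<le> measure_pmf.expectation P h"
    "measure_pmf.expectation P h \<le> 1"
proof -
  show "integrable (measure_pmf P) h"
    using assms by (intro measure_pmf.integrable_const_bound[where B=1]) auto
  then show "0 \<le> measure_pmf.expectation P h" "measure_pmf.expectation P h \<le> 1"
    using assms by (auto intro!: measure_pmf.integral_le_const)
qed

text \<open>The one-sided bound for indicators is enough, since passing to the complement of the
  event flips the sign of the difference.\<close>

lemma total_variation_le:
  assumes "tv_le P Q \<epsilon>"
  shows "total_variation P Q \<le> \<epsilon>"
  unfolding total_variation_def
proof (rule cSUP_least)
  fix A
  have 1: "measure_pmf.prob P A - measure_pmf.prob Q A \<le> \<epsilon>" for A
    using tv_leD[OF assms, of "indicator A"] by simp
  have "measure_pmf.prob M (- A) = 1 - measure_pmf.prob M A" for M :: "'a pmf"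
    by (subst Compl_eq_Diff_UNIV) (use measure_pmf.prob_compl[of A M] in simp)
  then show "\<bar>measure_pmf.prob P A - measure_pmf.prob Q A\<bar> \<le> \<epsilon>"
    using 1[of A] 1[of "- A"] by simp
qed simp

lemma tv_le_refl: "0 \<le> \<epsilon> \<Longrightarrow> tv_le P P \<epsilon>"
  by (simp add: tv_le_def)

lemma tv_le_trans: "tv_le P Q a \<Longrightarrow> tv_le Q R b \<Longrightarrow> tv_le P R (a + b)"
  unfolding tv_le_def by (smt (verit))

lemma tv_le_mono: "tv_le P Q a \<Longrightarrow> a \<le> b \<Longrightarrow> tv_le P Q b"
  unfolding tv_le_def by (smt (verit))

text \<open>Condition on the common first stage. On \<open>B\<close> the two expectations of a test
  function differ by at most 1, elsewhere by at most \<epsilon>; only points of the support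
  matter.\<close>

lemma tv_le_bind:
  assumes "\<And>x. x \<in> set_pmf M \<Longrightarrow> x \<notin> B \<Longrightarrow> tv_le (f x) (g x) \<epsilon>" and "0 \<le> \<epsilon>"
  shows "tv_le (bind_pmf M f) (bind_pmf M g) (measure_pmf.prob M B + \<epsilon>)"
  unfolding tv_le_def
proof safe
  fix h :: "'b \<Rightarrow> real"
  assume "\<forall>x. 0 \<le> h x \<and> h x \<le> 1"
  then have h: "\<And>x. 0 \<le> h x" "\<And>x. h x \<le> 1" by auto
  note E = expectation_unit_interval[of h, OF h]
  have int: "integrable (measure_pmf M) (\<lambda>x. measure_pmf.expectation (f x) h)" for f :: "'a \<Rightarrow> 'b pmf"
    using E by (intro expectation_unit_interval(1)) auto
  have "measure_pmf.expectation M (\<lambda>x. measure_pmf.expectation (f x) h)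
      - measure_pmf.expectation M (\<lambda>x. measure_pmf.expectation (g x) h)
    = measure_pmf.expectation M (\<lambda>x. measure_pmf.expectation (f x) h - measure_pmf.expectation (g x) h)"
    using int by simp
  also have "\<dots> \<le> measure_pmf.expectation M (\<lambda>x. indicator B x + \<epsilon>)"
  proof (rule integral_mono_AE)
    show "AE x in measure_pmf M. measure_pmf.expectation (f x) h - measure_pmf.expectation (g x) h
        \<le> indicator B x + \<epsilon>"
    proof (rule AE_pmfI)
      fix x assume x: "x \<in> set_pmf M"
      show "measure_pmf.expectation (f x) h - measure_pmf.expectation (g x) h \<le> indicator B x + \<epsilon>"
      proof (cases "x \<in> B")
        case True
        then have "indicator B x = (1::real)" by simp
        then show ?thesis using E(2)[of "g x"] E(3)[of "f x"] assms(2) by linarith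
      next
        case False
        then show ?thesis using tv_leD[OF assms(1)[OF x False], of h] h by simp
      qed
    qed
    show "integrable (measure_pmf M) (\<lambda>x. indicator B x + \<epsilon>)"
      using assms(2) by (intro measure_pmf.integrable_const_bound[where B="1 + \<epsilon>"]) (auto simp: indicator_def)
  qed (use int in auto)
  also have "\<dots> = measure_pmf.prob M B + \<epsilon>"
    by (subst Bochner_Integration.integral_add) (auto intro!: measure_pmf.integrable_const_bound[where B=1])
  finally show "measure_pmf.expectation (bind_pmf M f) h - measure_pmf.expectation (bind_pmf M g) h
      \<le> measure_pmf.prob M B + \<epsilon>"
    by (simp add: expectation_bind_pmf_bounded[of h 1, OF h])
qed

lemma tv_le_bind_const:
  assumes "\<And>x. x \<in> set_pmf M \<Longrightarrow> tv_le (f x) (g x) \<epsilon>"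
  shows "tv_le (bind_pmf M f) (bind_pmf M g) \<epsilon>"
proof -
  obtain x where "x \<in> set_pmf M" using set_pmf_not_empty[of M] by blast
  \<comment> \<open>The zero test function yields \<open>0 \<le> \<epsilon>\<close>, which
    \<open>tv_le_bind\<close> asks for.\<close>
  from tv_leD[OF assms[OF this], of "\<lambda>_. 0"] have "0 \<le> \<epsilon>" by simp
  then show ?thesis using tv_le_bind[of M "{}" f g \<epsilon>] assms by simp
qed

lemma tv_le_bind_left:
  assumes "tv_le M M' \<epsilon>"
  shows "tv_le (bind_pmf M f) (bind_pmf M' f) \<epsilon>"
  unfolding tv_le_def
proof safe
  fix h :: "'b \<Rightarrow> real"
  assume "\<forall>x. 0 \<le> h x \<and> h x \<le> 1"
  then have h: "\<And>x. 0 \<le> h x" "\<And>x. h x \<le> 1" by auto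
  show "measure_pmf.expectation (bind_pmf M f) h - measure_pmf.expectation (bind_pmf M' f) h \<le> \<epsilon>"
    using expectation_unit_interval[of h, OF h]
    by (simp add: expectation_bind_pmf_bounded[of h 1, OF h] tv_leD[OF assms])
qed

lemma tv_le_map: "tv_le M M' \<epsilon> \<Longrightarrow> tv_le (map_pmf f M) (map_pmf f M') \<epsilon>"
  unfolding map_pmf_def by (rule tv_le_bind_left)

text \<open>Hybrid argument: replace one coordinate at a time, so the errors add up.\<close>

lemma tv_le_Pi_pmf:
  assumes "finite I" and "\<And>i. i \<in> I \<Longrightarrow> tv_le (f i) (g i) (\<epsilon> i)"
  shows "tv_le (Pi_pmf I d f) (Pi_pmf I d g) (sum \<epsilon> I)"
  using assms
proof (induction I rule: finite_induct)
  case empty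
  show ?case by (simp add: tv_le_refl)
next
  case (insert i I)
  have "tv_le (Pi_pmf (insert i I) d f)
      (bind_pmf (g i) (\<lambda>y. bind_pmf (Pi_pmf I d f) (\<lambda>x. return_pmf (x(i := y))))) (\<epsilon> i)"
    unfolding Pi_pmf_insert'[OF insert.hyps] using insert.prems by (intro tv_le_bind_left) auto
  moreover have "tv_le (bind_pmf (g i) (\<lambda>y. bind_pmf (Pi_pmf I d f) (\<lambda>x. return_pmf (x(i := y)))))
      (Pi_pmf (insert i I) d g) (sum \<epsilon> I)"
    unfolding Pi_pmf_insert'[OF insert.hyps] using insert
    by (intro tv_le_bind_const tv_le_bind_left) auto
  ultimately show ?case using tv_le_trans insert.hyps by fastforce
qed

text \<open>A test function gains at most the positive part of \<open>P - Q\<close>. Both masses are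
  1, so the total positive part is half of the L1 distance.\<close>

lemma tv_le_of_L1:
  assumes A: "finite A" "set_pmf P \<subseteq> A" "set_pmf Q \<subseteq> A"
    and le: "(\<Sum>x\<in>A. \<bar>pmf P x - pmf Q x\<bar>) \<le> 2 * \<epsilon>"
  shows "tv_le P Q \<epsilon>"
  unfolding tv_le_def
proof safe
  fix h :: "'a \<Rightarrow> real"
  assume "\<forall>x. 0 \<le> h x \<and> h x \<le> 1"
  then have h: "\<And>x. 0 \<le> h x" "\<And>x. h x \<le> 1" by auto
  have E: "measure_pmf.expectation M h = (\<Sum>x\<in>A. h x * pmf M x)" if "set_pmf M \<subseteq> A" for M
    using A that by (intro integral_measure_pmf_real) auto
  have "measure_pmf.expectation P h - measure_pmf.expectation Q h
      = (\<Sum>x\<in>A. h x * (pmf P x - pmf Q x))"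
    using A by (simp add: E sum_subtractf algebra_simps)
  also have "\<dots> \<le> (\<Sum>x\<in>A. (\<bar>pmf P x - pmf Q x\<bar> + (pmf P x - pmf Q x)) / 2)"
  proof (rule sum_mono)
    fix x
    have "h x * (pmf P x - pmf Q x) \<le> 1 * (pmf P x - pmf Q x)" if "pmf P x \<ge> pmf Q x"
      using h that by (intro mult_right_mono) auto
    moreover have "h x * (pmf P x - pmf Q x) \<le> 0" if "pmf P x < pmf Q x"
      using h that by (intro mult_nonneg_nonpos) auto
    ultimately show "h x * (pmf P x - pmf Q x) \<le> (\<bar>pmf P x - pmf Q x\<bar> + (pmf P x - pmf Q x)) / 2"
      by (cases "pmf P x \<ge> pmf Q x") auto
  qed
  also have "\<dots> = ((\<Sum>x\<in>A. \<bar>pmf P x - pmf Q x\<bar>) + (sum (pmf P) A - sum (pmf Q) A)) / 2"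
    by (simp add: sum.distrib sum_subtractf sum_divide_distrib[symmetric])
  also have "\<dots> = (\<Sum>x\<in>A. \<bar>pmf P x - pmf Q x\<bar>) / 2"
    using A by (simp add: sum_pmf_eq_1)
  finally show "measure_pmf.expectation P h - measure_pmf.expectation Q h \<le> \<epsilon>"
    using le by simp
qed

section \<open>Independent random subsets\<close>

text \<open>The ground set is arbitrary, so that single blocks of pairs and whole graphs are handled
  by the same law.\<close>

definition indep_subset :: "'a set \<Rightarrow> ('a \<Rightarrow> real) \<Rightarrow> 'a set pmf" where
  "indep_subset D r = map_pmf (\<lambda>x. {e \<in> D. x e}) (Pi_pmf D False (\<lambda>e. bernoulli_pmf (r e)))"

lemma indep_edges_pmf_eq: "indep_edges_pmf V r = indep_subset ([V]\<^bsup>2\<^esup>) r"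
  by (simp add: indep_edges_pmf_def indep_subset_def)

lemma set_indep_subset: "set_pmf (indep_subset D r) \<subseteq> Pow D"
  by (auto simp: indep_subset_def)

lemma indep_subset_cong:
  "D = D' \<Longrightarrow> (\<And>e. e \<in> D' \<Longrightarrow> r e = r' e) \<Longrightarrow> indep_subset D r = indep_subset D' r'"
  unfolding indep_subset_def by (auto intro!: arg_cong[where f="map_pmf _"] Pi_pmf_cong)

lemma pmf_indep_subset:
  assumes "finite D" "\<And>e. e \<in> D \<Longrightarrow> 0 \<le> r e \<and> r e \<le> 1" "F \<subseteq> D"
  shows "pmf (indep_subset D r) F = (\<Prod>e\<in>D. if e \<in> F then r e else 1 - r e)"
proof -
  let ?M = "Pi_pmf D False (\<lambda>e. bernoulli_pmf (r e))"
  have "pmf (indep_subset D r) F = measure_pmf.prob ?M ((\<lambda>x. {e \<in> D. x e}) -` {F})"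
    by (simp add: indep_subset_def pmf_map)
  also have "\<dots> = measure_pmf.prob ?M {\<lambda>e. e \<in> F}"
  proof (intro measure_pmf.finite_measure_eq_AE AE_pmfI)
    fix x assume "x \<in> set_pmf ?M"
    \<comment> \<open>The default value \<open>False\<close> off \<open>D\<close> makes
      \<open>x\<close> the indicator of the set that it selects.\<close>
    then have "\<And>e. e \<notin> D \<Longrightarrow> \<not> x e"
      using set_Pi_pmf_subset[OF assms(1), of False "\<lambda>e. bernoulli_pmf (r e)"] by auto
    then show "x \<in> (\<lambda>x. {e \<in> D. x e}) -` {F} \<longleftrightarrow> x \<in> {\<lambda>e. e \<in> F}"
      using assms(3) by (auto simp: fun_eq_iff)
  qed auto
  also have "\<dots> = pmf ?M (\<lambda>e. e \<in> F)" by (simp add: measure_pmf_single)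
  also have "\<dots> = (\<Prod>e\<in>D. pmf (bernoulli_pmf (r e)) (e \<in> F))"
    using assms by (intro pmf_Pi') auto
  also have "\<dots> = (\<Prod>e\<in>D. if e \<in> F then r e else 1 - r e)"
    using assms by (intro prod.cong) auto
  finally show ?thesis .
qed

lemma indep_subset_Un:
  assumes "finite A" "finite B" "A \<inter> B = {}"
  shows "indep_subset (A \<union> B) r
    = map_pmf (\<lambda>(x, y). x \<union> y) (pair_pmf (indep_subset A r) (indep_subset B r))"
proof -
  have eq: "{e \<in> A \<union> B. if e \<in> A then f e else g e} = {e \<in> A. f e} \<union> {e \<in> B. g e}" for f g
    using assms(3) by auto
  show ?thesis
    unfolding indep_subset_def Pi_pmf_union[OF assms]
    by (simp only: map_pair[symmetric] pmf.map_comp o_def case_prod_beta eq fst_conv snd_conv)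
qed

text \<open>Used to reassemble a graph from independent blocks that partition its pairs.\<close>

lemma indep_subset_UNION:
  assumes "finite I" "\<And>i. i \<in> I \<Longrightarrow> finite (B i)" "disjoint_family_on B I"
  shows "map_pmf (\<lambda>F. \<Union>i\<in>I. F i) (Pi_pmf I {} (\<lambda>i. indep_subset (B i) r))
    = indep_subset (\<Union>i\<in>I. B i) r"
  using assms
proof (induction I rule: finite_induct)
  case empty
  show ?case by (simp add: indep_subset_def)
next
  case (insert i I)
  have dj: "B i \<inter> (\<Union>j\<in>I. B j) = {}"
    using insert.prems(2) insert.hyps by (fastforce simp: disjoint_family_on_def)
  have IH: "map_pmf (\<lambda>F. \<Union>i\<in>I. F i) (Pi_pmf I {} (\<lambda>i. indep_subset (B i) r))
    = indep_subset (\<Union>i\<in>I. B i) r"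
    using insert by (auto simp: disjoint_family_on_def)
  have eq: "(\<Union>j\<in>insert i I. (f(i := y)) j) = y \<union> (\<Union>j\<in>I. f j)" for f :: "_ \<Rightarrow> 'b set" and y
    using insert.hyps by auto
  have "map_pmf (\<lambda>F. \<Union>i\<in>insert i I. F i) (Pi_pmf (insert i I) {} (\<lambda>i. indep_subset (B i) r))
    = map_pmf (\<lambda>(x, y). x \<union> y) (pair_pmf (indep_subset (B i) r) (indep_subset (\<Union>i\<in>I. B i) r))"
    unfolding Pi_pmf_insert[OF insert.hyps] IH[symmetric] pair_map_pmf2
    by (simp only: pmf.map_comp o_def case_prod_beta eq fst_conv snd_conv fst_apsnd snd_apsnd)
  also have "\<dots> = indep_subset (\<Union>i\<in>insert i I. B i) r"
    using insert dj by (subst indep_subset_Un[symmetric]) auto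
  finally show ?case .
qed

text \<open>Only the count \<open>card F\<close> can produce \<open>F\<close>, and the binomial
  coefficient in the mass of the count cancels against the number of sets of that size.\<close>

lemma binomial_uniform_subset:
  assumes "finite B" "0 \<le> q" "q \<le> 1"
  shows "bind_pmf (binomial_pmf (card B) q) (\<lambda>c. pmf_of_set ([B]\<^bsup>c\<^esup>)) = indep_subset B (\<lambda>_. q)"
proof (rule pmf_eqI)
  fix F
  have pm: "pmf (pmf_of_set ([B]\<^bsup>c\<^esup>)) F
      = (if F \<subseteq> B \<and> c = card F then 1 / real (card B choose c) else 0)" if "c \<le> card B" for c
  proof -
    have "[B]\<^bsup>c\<^esup> \<noteq> {}" using that assms by (simp add: nsets_eq_empty_iff)
    moreover have "F \<in> [B]\<^bsup>c\<^esup> \<longleftrightarrow> F \<subseteq> B \<and> c = card F"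
      using assms finite_subset by (auto simp: nsets_def)
    ultimately show ?thesis
      using assms by (simp add: pmf_of_set finite_imp_finite_nsets card_nsets indicator_def)
  qed
  have L: "pmf (bind_pmf (binomial_pmf (card B) q) (\<lambda>c. pmf_of_set ([B]\<^bsup>c\<^esup>))) F
    = (\<Sum>c\<le>card B. if c = card F then (if F \<subseteq> B then q ^ c * (1 - q) ^ (card B - c) else 0) else 0)"
    unfolding pmf_bind using assms
    by (subst expectation_binomial_pmf', simp, intro sum.cong refl) (auto simp: pm)
  show "pmf (bind_pmf (binomial_pmf (card B) q) (\<lambda>c. pmf_of_set ([B]\<^bsup>c\<^esup>))) F
    = pmf (indep_subset B (\<lambda>_. q)) F"
  proof (cases "F \<subseteq> B")
    case True
    have "pmf (indep_subset B (\<lambda>_. q)) F = (\<Prod>e\<in>B. if e \<in> F then q else 1 - q)"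
      using True assms by (intro pmf_indep_subset) auto
    also have "\<dots> = q ^ card (B \<inter> F) * (1 - q) ^ card (B - F)"
      using assms by (simp add: prod.If_cases Diff_eq)
    also have "\<dots> = q ^ card F * (1 - q) ^ (card B - card F)"
      using True assms by (simp add: Int_absorb1 card_Diff_subset finite_subset)
    finally show ?thesis
      unfolding L using True assms by (simp add: card_mono)
  next
    case False
    then have "F \<notin> set_pmf (indep_subset B (\<lambda>_. q))" using set_indep_subset by blast
    then have "pmf (indep_subset B (\<lambda>_. q)) F = 0" by (simp add: set_pmf_iff)
    then show ?thesis unfolding L using False by simp
  qed
qed

lemma bernoulli_pmf_one: "bernoulli_pmf 1 = return_pmf True"
  by (rule pmf_eqI) (case_tac i, auto)

lemma indep_subset_one: "finite C \<Longrightarrow> indep_subset C (\<lambda>_. 1) = return_pmf C"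
  by (simp add: indep_subset_def bernoulli_pmf_one)

text \<open>With a fixed clique, planting keeps the edges independent and only raises the
  probabilities on the clique to 1: split \<open>D\<close> into \<open>C\<close>, where everything
  is forced, and \<open>D - C\<close>, where nothing changes.\<close>

lemma map_Un_indep_subset:
  assumes "finite D" "C \<subseteq> D"
  shows "map_pmf (\<lambda>G. G \<union> C) (indep_subset D r) = indep_subset D (\<lambda>e. if e \<in> C then 1 else r e)"
proof -
  have D: "D = (D - C) \<union> C" "finite (D - C)" "finite C" "(D - C) \<inter> C = {}"
    using assms finite_subset by auto
  have DD: "indep_subset D r
      = map_pmf (\<lambda>(x, y). x \<union> y) (pair_pmf (indep_subset (D - C) r) (indep_subset C r))" for r
    using indep_subset_Un[OF D(2-4), of r] unfolding D(1)[symmetric] .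
  have 1: "indep_subset (D - C) (\<lambda>e. if e \<in> C then 1 else r e) = indep_subset (D - C) r"
    by (rule indep_subset_cong) auto
  have 2: "indep_subset C (\<lambda>e. if e \<in> C then 1 else r e) = return_pmf C"
    using indep_subset_one[OF D(3)] by (metis (mono_tags, lifting) indep_subset_cong)
  have "map_pmf (\<lambda>G. G \<union> C) (indep_subset D r)
    = map_pmf (\<lambda>(x, y). x \<union> y \<union> C) (pair_pmf (indep_subset (D - C) r) (indep_subset C r))"
    unfolding DD by (simp add: pmf.map_comp o_def case_prod_unfold)
  also have "\<dots> = map_pmf (\<lambda>(x, y). x \<union> C) (pair_pmf (indep_subset (D - C) r) (indep_subset C r))"
    using set_indep_subset[of C r] by (intro map_pmf_cong) auto
  also have "\<dots> = map_pmf (\<lambda>x. x \<union> C) (indep_subset (D - C) r)"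
    using pmf.map_comp[of "\<lambda>x. x \<union> C" fst "pair_pmf (indep_subset (D - C) r) (indep_subset C r)"]
    by (simp add: map_fst_pair_pmf o_def case_prod_unfold)
  also have "\<dots> = indep_subset D (\<lambda>e. if e \<in> C then 1 else r e)"
    unfolding DD 1 2 by (simp add: pair_return_pmf2 pmf.map_comp o_def)
  finally show ?thesis .
qed

section \<open>The reduction as a product over blocks\<close>

lemma Pi_pmf_reindex:
  assumes "finite I" "inj_on e I"
  shows "Pi_pmf I d (\<lambda>i. f (e i))
    = map_pmf (\<lambda>x i. if i \<in> I then x (e i) else d) (Pi_pmf (e ` I) d f)"
  using assms
proof (induction I rule: finite_induct)
  case empty
  show ?case by simp
next
  case (insert i I)
  have ni: "e i \<notin> e ` I" "finite (e ` I)" "inj_on e I" using insert by auto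
  have eq: "(\<lambda>j. if j \<in> insert i I then (g(e i := y)) (e j) else d)
      = (\<lambda>j. if j \<in> I then g (e j) else d)(i := y)" for g y
  proof
    fix j
    show "(if j \<in> insert i I then (g(e i := y)) (e j) else d)
        = ((\<lambda>j. if j \<in> I then g (e j) else d)(i := y)) j"
    proof (cases "j \<in> I")
      case True
      then have "e j \<noteq> e i" "j \<noteq> i" using ni(1) insert.hyps by (metis image_eqI)+
      then show ?thesis using True by simp
    qed auto
  qed
  have "map_pmf (\<lambda>x j. if j \<in> insert i I then x (e j) else d) (Pi_pmf (e ` insert i I) d f)
    = map_pmf (\<lambda>(y, g). (\<lambda>j. if j \<in> I then g (e j) else d)(i := y))
        (pair_pmf (f (e i)) (Pi_pmf (e ` I) d f))"
    unfolding image_insert Pi_pmf_insert[OF ni(2,1)]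
    by (simp only: pmf.map_comp o_def case_prod_unfold eq)
  also have "\<dots> = Pi_pmf (insert i I) d (\<lambda>i. f (e i))"
    unfolding Pi_pmf_insert[OF insert.hyps] insert.IH[OF ni(3)] pair_map_pmf2
    by (simp only: pmf.map_comp o_def case_prod_unfold fst_apsnd snd_apsnd)
  finally show ?case ..
qed

text \<open>Coordinate \<open>i\<close> reads only the bit of the random set at \<open>e i\<close>.
  Distinct indices read distinct independent bits, so each bit can be drawn together with its
  coordinate.\<close>

lemma bind_indep_subset_Pi_pmf:
  assumes I: "finite I" and e: "inj_on e I" "D \<subseteq> e ` I"
    and h: "\<And>i b b'. i \<in> I \<Longrightarrow> e i \<notin> D \<Longrightarrow> h i b = h i b'"
  shows "bind_pmf (indep_subset D r) (\<lambda>G. Pi_pmf I d (\<lambda>i. h i (e i \<in> G)))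
    = Pi_pmf I d (\<lambda>i. bind_pmf (bernoulli_pmf (r (e i))) (h i))"
proof -
  let ?M = "Pi_pmf (e ` I) False (\<lambda>e. bernoulli_pmf (r e))"
  have fin: "finite (e ` I)" using I by simp
  have 1: "indep_subset D r = map_pmf (\<lambda>x. {e \<in> D. x e}) ?M"
    unfolding indep_subset_def Pi_pmf_subset[OF fin e(2)]
    by (simp add: pmf.map_comp o_def cong: conj_cong)
  have "bind_pmf (indep_subset D r) (\<lambda>G. Pi_pmf I d (\<lambda>i. h i (e i \<in> G)))
    = bind_pmf ?M (\<lambda>x. Pi_pmf I d (\<lambda>i. h i (e i \<in> D \<and> x (e i))))"
    unfolding 1 by (simp add: bind_map_pmf)
  \<comment> \<open>The product \<open>?M\<close> also carries bits at points outside
    \<open>D\<close>; by assumption \<open>h\<close> ignores those.\<close>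
  also have "\<dots> = bind_pmf ?M (\<lambda>x. Pi_pmf I d (\<lambda>i. h i (if i \<in> I then x (e i) else False)))"
  proof (intro bind_pmf_cong Pi_pmf_cong refl)
    fix x i assume "i \<in> I"
    then show "h i (e i \<in> D \<and> x (e i)) = h i (if i \<in> I then x (e i) else False)"
      using h[of i] by (cases "e i \<in> D") auto
  qed
  also have "\<dots> = bind_pmf (Pi_pmf I False (\<lambda>i. bernoulli_pmf (r (e i))))
      (\<lambda>y. Pi_pmf I d (\<lambda>i. h i (y i)))"
    unfolding Pi_pmf_reindex[OF I e(1), of False "\<lambda>e. bernoulli_pmf (r e)"] by (simp add: bind_map_pmf)
  also have "\<dots> = Pi_pmf I d (\<lambda>i. bind_pmf (bernoulli_pmf (r (e i))) (h i))"
    by (rule Pi_pmf_bind[OF I, symmetric])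
  finally show ?thesis .
qed

definition fibre :: "nat \<Rightarrow> (nat \<Rightarrow> nat) \<Rightarrow> nat \<Rightarrow> nat set" where
  "fibre N \<phi> s = {v \<in> {1..N}. \<phi> v = s}"

definition index_pairs :: "nat \<Rightarrow> (nat \<times> nat) set" where
  "index_pairs n = {(s, t). 1 \<le> s \<and> s \<le> t \<and> t \<le> n}"

text \<open>\<open>UNIV\<close> and \<open>{}\<close> stand for any graph with or without the edge
  \<open>{s, t}\<close>, which is all that \<open>edge_count_pmf\<close> reads of the graph. For
  \<open>s = t\<close> the bit is drawn and ignored.\<close>

definition block_law ::
  "nat \<Rightarrow> real \<Rightarrow> nat \<Rightarrow> real \<Rightarrow> real \<Rightarrow> (nat \<Rightarrow> nat set) \<Rightarrow> (nat set \<Rightarrow> real) \<Rightarrow> nat \<times> nat \<Rightarrow> graph pmf"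
where
  "block_law l \<gamma> m0 p q V r = (\<lambda>(s, t).
     do {
       b \<leftarrow> bernoulli_pmf (r {s, t});
       c \<leftarrow> edge_count_pmf l \<gamma> m0 p q (if b then UNIV else {}) V (s, t);
       pmf_of_set ([pairs_between (V s) (V t)]\<^bsup>c\<^esup>)
     })"

lemma finite_index_pairs: "finite (index_pairs n)"
  by (rule finite_subset[of _ "{1..n} \<times> {1..n}"]) (auto simp: index_pairs_def)

text \<open>Parents and input graph are independent, so the parents may be drawn first. Given them,
  each block reads its own bit of the input graph, and independent input edges make the blocks
  independent.\<close>

lemma bind_clique_reduction:
  "bind_pmf (indep_subset ([{1..n}]\<^bsup>2\<^esup>) r) (clique_reduction n N l \<gamma> m0 p q)
    = bind_pmf (Pi_pmf {1..N} 0 (\<lambda>_. pmf_of_set {1..n}))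
        (\<lambda>\<phi>. map_pmf (\<lambda>F. \<Union>i\<in>index_pairs n. F i)
          (Pi_pmf (index_pairs n) {} (block_law l \<gamma> m0 p q (fibre N \<phi>) r)))"
proof -
  let ?I = "index_pairs n"
  let ?u = "\<lambda>V (s, t) c. pmf_of_set ([pairs_between (V s) (V t)]\<^bsup>c\<^esup>)"
  let ?h = "\<lambda>V i b. bind_pmf (edge_count_pmf l \<gamma> m0 p q (if b then UNIV else {}) V i) (?u V i)"
  let ?e = "\<lambda>(s, t). {s, t} :: nat set"
  have inj: "inj_on ?e ?I"
    by (auto simp: inj_on_def index_pairs_def doubleton_eq_iff)
  have sub: "[{1..n}]\<^bsup>2\<^esup> \<subseteq> ?e ` ?I"
  proof
    fix x assume "x \<in> [{1..n}]\<^bsup>2\<^esup>"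
    then obtain u v where uv: "x = {u, v}" "u \<in> {1..n}" "v \<in> {1..n}" "u \<noteq> v"
      by (auto elim!: nsets2_E)
    show "x \<in> ?e ` ?I"
    proof (cases "u \<le> v")
      case True
      then have "(u, v) \<in> ?I" using uv by (auto simp: index_pairs_def)
      then show ?thesis using uv by force
    next
      case False
      then have "(v, u) \<in> ?I" using uv by (auto simp: index_pairs_def)
      then show ?thesis using uv by (force simp: insert_commute)
    qed
  qed
  \<comment> \<open>An index whose pair is not an edge slot is diagonal, and there the count law
    does not look at the graph.\<close>
  have diag: "?h V i b = ?h V i b'" if i: "i \<in> ?I" "?e i \<notin> [{1..n}]\<^bsup>2\<^esup>" for V i b b'
  proof -
    have "fst i = snd i" using i by (auto simp: index_pairs_def)
    then show ?thesis by (cases i) (simp add: edge_count_pmf_def)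
  qed
  have count: "edge_count_pmf l \<gamma> m0 p q G V i
      = edge_count_pmf l \<gamma> m0 p q (if ?e i \<in> G then UNIV else {}) V i" for G V i
    by (cases i) (simp add: edge_count_pmf_def)
  \<comment> \<open>Drawing all counts and then all edge sets is the same as doing both index by
    index.\<close>
  have red: "clique_reduction n N l \<gamma> m0 p q G
    = bind_pmf (Pi_pmf {1..N} 0 (\<lambda>_. pmf_of_set {1..n}))
        (\<lambda>\<phi>. map_pmf (\<lambda>F. \<Union>i\<in>?I. F i)
          (Pi_pmf ?I {} (\<lambda>i. ?h (fibre N \<phi>) i (?e i \<in> G))))" for G
  proof -
    have "bind_pmf (Pi_pmf ?I 0 (edge_count_pmf l \<gamma> m0 p q G V))
        (\<lambda>E. bind_pmf (Pi_pmf ?I {} (\<lambda>(s, t). pmf_of_set ([pairs_between (V s) (V t)]\<^bsup>E (s, t)\<^esup>)))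
          (\<lambda>F. return_pmf (\<Union>i\<in>?I. F i)))
      = map_pmf (\<lambda>F. \<Union>i\<in>?I. F i) (Pi_pmf ?I {} (\<lambda>i. ?h V i (?e i \<in> G)))" for V
    proof -
      have c: "edge_count_pmf l \<gamma> m0 p q G V
          = (\<lambda>i. edge_count_pmf l \<gamma> m0 p q (if ?e i \<in> G then UNIV else {}) V i)"
        using count by (rule ext)
      have u: "(\<lambda>(s, t). pmf_of_set ([pairs_between (V s) (V t)]\<^bsup>E (s, t)\<^esup>)) = (\<lambda>i. ?u V i (E i))" for E
        by auto
      show ?thesis
        unfolding u c Pi_pmf_bind[OF finite_index_pairs, where d'=0] map_bind_pmf
        by (simp add: map_pmf_def)
    qed
    then show ?thesis
      unfolding clique_reduction_def Let_def index_pairs_def[symmetric] fibre_def[symmetric, abs_def]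
      by (simp only:)
  qed
  have bl: "block_law l \<gamma> m0 p q V r = (\<lambda>i. bind_pmf (bernoulli_pmf (r (?e i))) (?h V i))" for V
    by (auto simp: block_law_def fun_eq_iff)
  have "bind_pmf (indep_subset ([{1..n}]\<^bsup>2\<^esup>) r) (clique_reduction n N l \<gamma> m0 p q)
    = bind_pmf (Pi_pmf {1..N} 0 (\<lambda>_. pmf_of_set {1..n}))
        (\<lambda>\<phi>. map_pmf (\<lambda>F. \<Union>i\<in>?I. F i) (bind_pmf (indep_subset ([{1..n}]\<^bsup>2\<^esup>) r)
          (\<lambda>G. Pi_pmf ?I {} (\<lambda>i. ?h (fibre N \<phi>) i (?e i \<in> G)))))"
    unfolding red map_bind_pmf by (rule bind_commute_pmf)
  also have "\<dots> = bind_pmf (Pi_pmf {1..N} 0 (\<lambda>_. pmf_of_set {1..n}))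
        (\<lambda>\<phi>. map_pmf (\<lambda>F. \<Union>i\<in>?I. F i) (Pi_pmf ?I {} (block_law l \<gamma> m0 p q (fibre N \<phi>) r)))"
    unfolding bl using bind_indep_subset_Pi_pmf[OF finite_index_pairs inj sub, of "?h (fibre N _)" r "{}"] diag
    by (intro bind_pmf_cong refl arg_cong[where f="map_pmf _"]) blast
  finally show ?thesis .
qed

section \<open>Blocks of pairs between the fibres of a parent map\<close>

lemma finite_pairs_between: "finite A \<Longrightarrow> finite B \<Longrightarrow> finite (pairs_between A B)"
  by (rule finite_subset[of _ "(\<lambda>(u, v). {u, v}) ` (A \<times> B)"]) (auto simp: pairs_between_def)

lemma pairs_between_self: "pairs_between A A = [A]\<^bsup>2\<^esup>"
  by (auto simp: pairs_between_def nsets_2_eq)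

lemma card_pairs_between:
  assumes "A \<inter> B = {}"
  shows "card (pairs_between A B) = card A * card B"
proof -
  have "pairs_between A B = (\<lambda>(u, v). {u, v}) ` (A \<times> B)"
    using assms unfolding pairs_between_def by (auto; metis disjoint_iff)
  moreover have "inj_on (\<lambda>(u, v). {u, v}) (A \<times> B)"
    using assms by (auto simp: inj_on_def doubleton_eq_iff)
  ultimately show ?thesis by (simp add: card_image card_cartesian_product)
qed

lemma finite_fibre: "finite (fibre N \<phi> s)"
  by (simp add: fibre_def)

lemma disjoint_blocks:
  "disjoint_family_on (\<lambda>(s, t). pairs_between (fibre N \<phi> s) (fibre N \<phi> t)) (index_pairs n)"
  unfolding disjoint_family_on_def
  by (auto simp: index_pairs_def pairs_between_def fibre_def doubleton_eq_iff)

text \<open>A pair belongs to the block indexed by the parents of its two endpoints, put in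
  increasing order.\<close>

lemma UN_blocks:
  assumes "\<And>v. v \<in> {1..N} \<Longrightarrow> \<phi> v \<in> {1..n}"
  shows "(\<Union>(s, t)\<in>index_pairs n. pairs_between (fibre N \<phi> s) (fibre N \<phi> t)) = [{1..N}]\<^bsup>2\<^esup>"
proof (intro equalityI subsetI)
  fix x assume "x \<in> [{1..N}]\<^bsup>2\<^esup>"
  then obtain u v where uv: "x = {u, v}" "u \<in> {1..N}" "v \<in> {1..N}" "u \<noteq> v"
    by (auto elim!: nsets2_E)
  have *: "x \<in> (\<Union>(s, t)\<in>index_pairs n. pairs_between (fibre N \<phi> s) (fibre N \<phi> t))"
    if "x = {u, v}" "u \<in> {1..N}" "v \<in> {1..N}" "u \<noteq> v" "\<phi> u \<le> \<phi> v" for u v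
  proof -
    have "(\<phi> u, \<phi> v) \<in> index_pairs n" using assms[of u] assms[of v] that by (auto simp: index_pairs_def)
    moreover have "x \<in> pairs_between (fibre N \<phi> (\<phi> u)) (fibre N \<phi> (\<phi> v))"
      using that by (auto simp: pairs_between_def fibre_def)
    ultimately show ?thesis by blast
  qed
  show "x \<in> (\<Union>(s, t)\<in>index_pairs n. pairs_between (fibre N \<phi> s) (fibre N \<phi> t))"
    using *[of u v] *[of v u] uv by (cases "\<phi> u \<le> \<phi> v") (auto simp: insert_commute)
qed (auto simp: pairs_between_def fibre_def)

text \<open>The term \<open>2 * x ^ (a + j)\<close> bounds the rest of the series for ratio at most
  1/2; carrying it along makes the induction close.\<close>

lemma geometric_tail_le:
  fixes x :: real
  assumes "0 \<le> x" "x \<le> 1 / 2"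
  shows "(\<Sum>m\<in>{a..<a + j}. x ^ m) + 2 * x ^ (a + j) \<le> 2 * x ^ a"
proof (induction j)
  case (Suc j)
  have "x * x ^ (a + j) \<le> 1 / 2 * x ^ (a + j)" using assms by (intro mult_right_mono) auto
  then show ?case using Suc by (simp add: sum.atLeastLessThan_Suc)
qed simp

section \<open>Exact and approximate laws of a single block\<close>

locale reduction =
  fixes l m0 :: nat and \<gamma> q :: real
  assumes l1: "1 \<le> l" and \<gamma>: "0 < \<gamma>" "\<gamma> \<le> 1 / 2" and q: "0 < q"
    and m0: "m0 = nat \<lfloor>log 2 (1 / \<gamma>)\<rfloor>" and ql: "16 * q * real l ^ 2 \<le> 1"
begin

lemma q_le: "q \<le> 1 / 16"
proof -
  have "1 \<le> real l ^ 2" using l1 by (simp add: one_le_power)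
  then have "16 * q * 1 \<le> 16 * q * real l ^ 2" using q by (intro mult_left_mono) auto
  then show ?thesis using ql by simp
qed

text \<open>Beyond the cutoff \<open>m0\<close> the factor \<open>1 / \<gamma>\<close> is at most
  \<open>2 ^ m\<close>, hence is absorbed by passing from \<open>q ^ m\<close> to
  \<open>(2 * q) ^ m\<close>.\<close>

lemma inverse_gamma_less: "1 / \<gamma> < 2 ^ (m0 + 1)"
proof -
  have "log 2 (1 / \<gamma>) < real (m0 + 1)" unfolding m0 by linarith
  then have "1 / \<gamma> < 2 powr real (m0 + 1)"
    using \<gamma> log_less_iff[of 2 "1 / \<gamma>" "real (m0 + 1)"] by auto
  then show ?thesis by (simp only: powr_realpow)
qed

context
  fixes ls lt :: nat
  assumes ls: "ls \<le> 2 * l" and lt: "lt \<le> 2 * l"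
begin

lemmas pmf_P' = pmf_P'_pmf[OF \<gamma> q l1 m0 ql ls lt refl]
lemmas pmf_Q' = pmf_Q'_pmf[OF \<gamma> q l1 m0 ql ls lt refl]

text \<open>\<open>Q'_mass\<close> is the rescaled remainder of the binomial mass after \<gamma>
  times \<open>P'_mass\<close> is removed, so the mixture restores it. The fibre bounds make both
  embedded functions genuine mass functions.\<close>

lemma mixture_P'_Q':
  "bind_pmf (bernoulli_pmf \<gamma>)
     (\<lambda>b. if b then P'_pmf \<gamma> m0 (2 * q) q (ls * lt) else Q'_pmf \<gamma> m0 (2 * q) q (ls * lt))
   = binomial_pmf (ls * lt) q"
proof (rule pmf_eqI)
  fix m
  have "\<gamma> * a + (1 - \<gamma>) * (1 / (1 - \<gamma>) * (b - \<gamma> * a)) = b" for a b :: real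
    using \<gamma> by (simp add: field_simps)
  then show "pmf (bind_pmf (bernoulli_pmf \<gamma>)
     (\<lambda>b. if b then P'_pmf \<gamma> m0 (2 * q) q (ls * lt) else Q'_pmf \<gamma> m0 (2 * q) q (ls * lt))) m
    = pmf (binomial_pmf (ls * lt) q) m"
    unfolding pmf_bind using \<gamma> by (simp add: pmf_P' pmf_Q' Q'_mass_def del: pmf_binomial)
qed

text \<open>The two laws differ only beyond \<open>m0\<close> and at 0, where the excess is
  compensated. With \<open>x = 8 q l^2\<close>, which dominates \<open>2 q\<close> times the number
  of pairs, each tail difference is at most \<open>x ^ m\<close>, the tail sums to at most
  \<open>2 x ^ (m0 + 1)\<close>, and the correction at 0 is no larger.\<close>

lemma tv_le_P'_binomial:
  "tv_le (P'_pmf \<gamma> m0 (2 * q) q (ls * lt)) (binomial_pmf (ls * lt) (2 * q))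
     (2 * (8 * q * real l ^ 2) ^ (m0 + 1))"
proof (rule tv_le_of_L1[where A="{..ls * lt}"])
  let ?M = "ls * lt" and ?x = "8 * q * real l ^ 2"
  let ?P = "pmf (binomial_pmf ?M (2 * q))" and ?Q = "pmf (binomial_pmf ?M q)"
  let ?P' = "P'_mass \<gamma> m0 (2 * q) q ?M"
  have bin: "?P m = real (?M choose m) * (2 * q) ^ m * (1 - 2 * q) ^ (?M - m)"
    "?Q m = real (?M choose m) * q ^ m * (1 - q) ^ (?M - m)" for m
    using q q_le by auto
  show "set_pmf (binomial_pmf ?M (2 * q)) \<subseteq> {..?M}" using q q_le by auto
  show "set_pmf (P'_pmf \<gamma> m0 (2 * q) q ?M) \<subseteq> {..?M}"
  proof
    fix m assume m: "m \<in> set_pmf (P'_pmf \<gamma> m0 (2 * q) q ?M)"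
    show "m \<in> {..?M}"
    proof (rule ccontr)
      assume "m \<notin> {..?M}"
      then have "?P' m = 0" using q q_le by (auto simp: P'_mass_def)
      with m show False by (simp add: set_pmf_iff pmf_P')
    qed
  qed
  have M: "real ?M \<le> 4 * real l ^ 2"
  proof -
    have "?M \<le> (2 * l) * (2 * l)" using ls lt by (rule mult_le_mono)
    then have "real ?M \<le> real ((2 * l) * (2 * l))" by (simp only: of_nat_le_iff)
    then show ?thesis by (simp add: power2_eq_square)
  qed
  have tail: "\<bar>?P m - 1 / \<gamma> * ?Q m\<bar> \<le> ?x ^ m" if m: "m \<in> {m0<..?M}" for m
  proof -
    have "real (?M choose m) \<le> real ?M ^ m"
      using binomial_le_pow[of m ?M] m by (metis greaterThanAtMost_iff of_nat_le_iff of_nat_power)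
    then have "real (?M choose m) * (2 * q) ^ m \<le> real ?M ^ m * (2 * q) ^ m"
      using q by (intro mult_right_mono) auto
    also have "\<dots> = (real ?M * (2 * q)) ^ m" by (simp only: power_mult_distrib)
    also have "\<dots> \<le> ?x ^ m"
    proof (rule power_mono)
      have "real ?M * (2 * q) \<le> (4 * real l ^ 2) * (2 * q)" using M q by (intro mult_right_mono) auto
      then show "real ?M * (2 * q) \<le> ?x" by simp
    qed (use q in auto)
    finally have c: "real (?M choose m) * (2 * q) ^ m \<le> ?x ^ m" .
    have "?P m \<le> real (?M choose m) * (2 * q) ^ m * 1"
      unfolding bin using q q_le by (intro mult_left_mono power_le_one) auto
    then have P: "?P m \<le> ?x ^ m" using c by simp
    have "(2::real) ^ (m0 + 1) \<le> 2 ^ m" using m by (intro power_increasing) auto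
    then have g: "1 / \<gamma> \<le> 2 ^ m" using inverse_gamma_less by linarith
    have "?Q m \<le> real (?M choose m) * q ^ m * 1"
      unfolding bin using q q_le by (intro mult_left_mono power_le_one) auto
    then have "1 / \<gamma> * ?Q m \<le> 2 ^ m * (real (?M choose m) * q ^ m)"
      using g \<gamma> by (intro mult_mono) (auto intro!: pmf_nonneg simp del: pmf_binomial)
    also have "\<dots> = real (?M choose m) * (2 * q) ^ m" by (simp add: power_mult_distrib)
    finally have Q: "1 / \<gamma> * ?Q m \<le> ?x ^ m" using c by linarith
    \<comment> \<open>Both quantities lie between 0 and \<open>?x ^ m\<close>, hence so does the
      absolute value of their difference.\<close>
    have "0 \<le> 1 / \<gamma> * ?Q m" using \<gamma> by (intro mult_nonneg_nonneg pmf_nonneg) auto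
    then show ?thesis using P Q pmf_nonneg[of "binomial_pmf ?M (2 * q)" m] by linarith
  qed
  have x: "0 \<le> ?x" "?x \<le> 1 / 2" using q ql by auto
  have T: "(\<Sum>m\<in>{m0<..?M}. \<bar>?P m - 1 / \<gamma> * ?Q m\<bar>) \<le> 2 * ?x ^ (m0 + 1)"
  proof -
    have "(\<Sum>m\<in>{m0<..?M}. \<bar>?P m - 1 / \<gamma> * ?Q m\<bar>) \<le> (\<Sum>m\<in>{m0<..?M}. ?x ^ m)"
      using tail by (rule sum_mono)
    also have "\<dots> \<le> (\<Sum>m\<in>{m0 + 1..<m0 + 1 + ?M}. ?x ^ m)"
      using x by (intro sum_mono2) auto
    also have "\<dots> \<le> 2 * ?x ^ (m0 + 1)"
      using geometric_tail_le[OF x, of "m0 + 1" ?M] zero_le_power[OF x(1), of "m0 + 1 + ?M"] by linarith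
    finally show ?thesis .
  qed
  have "(\<Sum>m\<le>?M. \<bar>?P' m - ?P m\<bar>)
      \<le> (\<Sum>m\<le>?M. (if m = 0 then \<bar>excess_mass \<gamma> m0 (2 * q) q ?M\<bar> else 0)
          + (if m \<in> {m0<..?M} then \<bar>?P m - 1 / \<gamma> * ?Q m\<bar> else 0))"
    by (intro sum_mono) (auto simp: P'_mass_def simp del: pmf_binomial)
  also have "\<dots> = \<bar>excess_mass \<gamma> m0 (2 * q) q ?M\<bar> + (\<Sum>m\<in>{m0<..?M}. \<bar>?P m - 1 / \<gamma> * ?Q m\<bar>)"
  proof -
    have "{..?M} \<inter> {m0<..?M} = {m0<..?M}" by auto
    then show ?thesis
      using sum.inter_restrict[of "{..?M}" "\<lambda>m. \<bar>?P m - 1 / \<gamma> * ?Q m\<bar>" "{m0<..?M}"]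
      by (simp add: sum.distrib del: pmf_binomial)
  qed
  also have "\<dots> \<le> 2 * (2 * ?x ^ (m0 + 1))"
    using T sum_abs[of "\<lambda>m. ?P m - 1 / \<gamma> * ?Q m" "{m0<..?M}"] unfolding excess_mass_def by linarith
  finally show "(\<Sum>m\<le>?M. \<bar>pmf (P'_pmf \<gamma> m0 (2 * q) q ?M) m - ?P m\<bar>) \<le> 2 * (2 * ?x ^ (m0 + 1))"
    by (simp only: pmf_P')
qed simp

end

lemma block_law_diagonal:
  assumes "finite (V s)"
  shows "block_law l \<gamma> m0 (2 * q) q V r (s, s) = indep_subset (pairs_between (V s) (V s)) (\<lambda>_. q)"
proof -
  have "card (V s) choose 2 = card (pairs_between (V s) (V s))"
    by (simp add: pairs_between_self card_nsets)
  then show ?thesis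
    using assms q q_le binomial_uniform_subset[of "pairs_between (V s) (V s)" q]
    by (simp add: block_law_def edge_count_pmf_def finite_pairs_between)
qed

context
  fixes V :: "nat \<Rightarrow> nat set" and s t :: nat
  assumes st: "s \<noteq> t" "V s \<inter> V t = {}" "finite (V s)" "finite (V t)"
begin

lemma binomial_uniform_pairs:
  assumes "0 \<le> x" "x \<le> 1"
  shows "bind_pmf (binomial_pmf (card (V s) * card (V t)) x)
      (\<lambda>c. pmf_of_set ([pairs_between (V s) (V t)]\<^bsup>c\<^esup>))
    = indep_subset (pairs_between (V s) (V t)) (\<lambda>_. x)"
  using binomial_uniform_subset[of "pairs_between (V s) (V t)" x] assms st
  by (simp add: card_pairs_between finite_pairs_between)

lemma block_law_large:
  assumes "max (card (V s)) (card (V t)) > 2 * l"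
  shows "block_law l \<gamma> m0 (2 * q) q V r (s, t) = indep_subset (pairs_between (V s) (V t)) (\<lambda>_. q)"
  using assms st q q_le binomial_uniform_pairs[of q] by (simp add: block_law_def edge_count_pmf_def)

text \<open>For small fibres the random bit mixes \<open>P'\<close> and \<open>Q'\<close> back to a
  binomial count; for a large fibre the count is binomial whatever the bit is.\<close>

lemma block_law_gamma:
  assumes "r {s, t} = \<gamma>"
  shows "block_law l \<gamma> m0 (2 * q) q V r (s, t) = indep_subset (pairs_between (V s) (V t)) (\<lambda>_. q)"
proof (cases "max (card (V s)) (card (V t)) > 2 * l")
  case False
  then have le: "card (V s) \<le> 2 * l" "card (V t) \<le> 2 * l" by auto
  have "block_law l \<gamma> m0 (2 * q) q V r (s, t)
    = bind_pmf (bind_pmf (bernoulli_pmf \<gamma>) (\<lambda>b. edge_count_pmf l \<gamma> m0 (2 * q) q (if b then UNIV else {}) V (s, t)))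
        (\<lambda>c. pmf_of_set ([pairs_between (V s) (V t)]\<^bsup>c\<^esup>))"
    using assms by (simp add: block_law_def bind_assoc_pmf)
  also have "bind_pmf (bernoulli_pmf \<gamma>) (\<lambda>b. edge_count_pmf l \<gamma> m0 (2 * q) q (if b then UNIV else {}) V (s, t))
    = binomial_pmf (card (V s) * card (V t)) q"
    unfolding mixture_P'_Q'[OF le, symmetric] using False st
    by (intro bind_pmf_cong) (auto simp: edge_count_pmf_def)
  also have "bind_pmf \<dots> (\<lambda>c. pmf_of_set ([pairs_between (V s) (V t)]\<^bsup>c\<^esup>))
      = indep_subset (pairs_between (V s) (V t)) (\<lambda>_. q)"
    using q q_le by (intro binomial_uniform_pairs) auto
  finally show ?thesis .
qed (rule block_law_large)

text \<open>A forced edge makes the count law \<open>P'\<close>; choosing the edge set given the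
  count is a common kernel, which cannot increase the distance.\<close>

lemma tv_le_block_law_one:
  assumes "r {s, t} = 1" "card (V s) \<le> 2 * l" "card (V t) \<le> 2 * l"
  shows "tv_le (block_law l \<gamma> m0 (2 * q) q V r (s, t))
    (indep_subset (pairs_between (V s) (V t)) (\<lambda>_. 2 * q)) (2 * (8 * q * real l ^ 2) ^ (m0 + 1))"
proof -
  have "block_law l \<gamma> m0 (2 * q) q V r (s, t)
    = bind_pmf (P'_pmf \<gamma> m0 (2 * q) q (card (V s) * card (V t)))
        (\<lambda>c. pmf_of_set ([pairs_between (V s) (V t)]\<^bsup>c\<^esup>))"
    using assms st max.bounded_iff[of "card (V s)" "card (V t)" "2 * l"]
    by (simp add: block_law_def edge_count_pmf_def bernoulli_pmf_one bind_return_pmf not_less[symmetric])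
  moreover have "indep_subset (pairs_between (V s) (V t)) (\<lambda>_. 2 * q)
    = bind_pmf (binomial_pmf (card (V s) * card (V t)) (2 * q))
        (\<lambda>c. pmf_of_set ([pairs_between (V s) (V t)]\<^bsup>c\<^esup>))"
    using q q_le by (intro binomial_uniform_pairs[symmetric]) auto
  ultimately show ?thesis using tv_le_bind_left[OF tv_le_P'_binomial[OF assms(2,3)]] by simp
qed

end

text \<open>The output has the target law conditionally on every parent map, so averaging over the
  parents changes nothing.\<close>

lemma erdos_renyi_reduction:
  assumes "1 \<le> n"
  shows "bind_pmf (erdos_renyi n \<gamma>) (clique_reduction n N l \<gamma> m0 (2 * q) q) = erdos_renyi N q"
proof -
  have "map_pmf (\<lambda>F. \<Union>i\<in>index_pairs n. F i)
          (Pi_pmf (index_pairs n) {} (block_law l \<gamma> m0 (2 * q) q (fibre N \<phi>) (\<lambda>_. \<gamma>)))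
     = indep_subset ([{1..N}]\<^bsup>2\<^esup>) (\<lambda>_. q)"
    if \<phi>: "\<phi> \<in> set_pmf (Pi_pmf {1..N} 0 (\<lambda>_. pmf_of_set {1..n}))" for \<phi>
  proof -
    let ?B = "\<lambda>(s, t). pairs_between (fibre N \<phi> s) (fibre N \<phi> t)"
    have rng: "\<phi> v \<in> {1..n}" if "v \<in> {1..N}" for v
      using that \<phi> assms by (auto simp: set_Pi_pmf PiE_dflt_def)
    have "block_law l \<gamma> m0 (2 * q) q (fibre N \<phi>) (\<lambda>_. \<gamma>) i = indep_subset (?B i) (\<lambda>_. q)" for i
    proof (cases i)
      case (Pair s t)
      have "s \<noteq> t \<Longrightarrow> fibre N \<phi> s \<inter> fibre N \<phi> t = {}" by (auto simp: fibre_def)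
      then show ?thesis
        using block_law_diagonal block_law_gamma finite_fibre Pair by (cases "s = t") auto
    qed
    then have "block_law l \<gamma> m0 (2 * q) q (fibre N \<phi>) (\<lambda>_. \<gamma>) = (\<lambda>i. indep_subset (?B i) (\<lambda>_. q))"
      by (rule ext)
    then show ?thesis
      using indep_subset_UNION[OF finite_index_pairs _ disjoint_blocks, of n N \<phi> "\<lambda>_. q"]
        UN_blocks[OF rng] by (auto simp: finite_pairs_between finite_fibre)
  qed
  then show ?thesis
    unfolding erdos_renyi_def indep_edges_pmf_eq bind_clique_reduction
    by (simp cong: bind_pmf_cong)
qed

end

section \<open>Tail bounds and the second moment method\<close>

text \<open>Exponential Markov inequality: the binomial theorem evaluates the moment generating
  function, and \<open>1 + x \<le> exp x\<close> bounds it.\<close>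

lemma binomial_chernoff:
  assumes "0 \<le> p" "p \<le> 1" "0 \<le> t"
  shows "measure_pmf.prob (binomial_pmf n p) {k. a \<le> real k}
    \<le> exp (real n * p * (exp t - 1) - t * a)"
proof -
  have p: "p \<in> {0..1}" using assms by simp
  have "measure_pmf.prob (binomial_pmf n p) {k. a \<le> real k}
      = measure_pmf.expectation (binomial_pmf n p) (indicator {k. a \<le> real k})"
    by simp
  also have "\<dots> \<le> measure_pmf.expectation (binomial_pmf n p) (\<lambda>k. exp (t * (real k - a)))"
    using p assms(3) by (intro integral_mono integrable_binomial_pmf) (auto simp: indicator_def)
  also have "\<dots> = exp (- (t * a)) * (\<Sum>k\<le>n. real (n choose k) * (p * exp t) ^ k * (1 - p) ^ (n - k))"
    unfolding expectation_binomial_pmf'[OF p] sum_distrib_left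
    by (intro sum.cong refl)
       (simp add: right_diff_distrib exp_diff exp_minus power_mult_distrib exp_of_nat_mult[symmetric]
         field_simps)
  also have "(\<Sum>k\<le>n. real (n choose k) * (p * exp t) ^ k * (1 - p) ^ (n - k)) = (p * exp t + (1 - p)) ^ n"
    by (simp add: binomial_ring)
  also have "\<dots> \<le> exp (p * (exp t - 1)) ^ n"
  proof (rule power_mono)
    show "p * exp t + (1 - p) \<le> exp (p * (exp t - 1))"
      using exp_ge_add_one_self[of "p * (exp t - 1)"] by (simp add: algebra_simps)
  qed (use assms in auto)
  also have "exp (- (t * a)) * exp (p * (exp t - 1)) ^ n = exp (real n * p * (exp t - 1) - t * a)"
    by (simp add: exp_of_nat_mult[symmetric] exp_add[symmetric] mult_ac)
  finally show ?thesis by simp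
qed

lemma exp_numeric_bounds:
  "exp (2 / 5 :: real) \<le> 91 / 60" "exp (3 / 10 :: real) \<le> 49 / 36"
proof -
  \<comment> \<open>The estimate \<open>exp x \<le> 1 + x + x^2\<close> is too weak at 2/5 and 3/10
    themselves, so it is applied at 1/20 and raised to a power.\<close>
  have b: "exp (1 / 20 :: real) \<le> 421 / 400"
    using exp_bound[of "1 / 20"] by (simp add: power2_eq_square)
  have "exp (2 / 5 :: real) = exp (1 / 20) ^ 8" "exp (3 / 10 :: real) = exp (1 / 20) ^ 6"
    by (simp_all flip: exp_of_nat_mult)
  moreover have "exp (1 / 20 :: real) ^ 8 \<le> (421 / 400) ^ 8" "exp (1 / 20 :: real) ^ 6 \<le> (421 / 400) ^ 6"
    using b by (intro power_mono; simp)+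
  moreover have "(421 / 400 :: real) ^ 8 \<le> 91 / 60" "(421 / 400 :: real) ^ 6 \<le> 49 / 36"
    by (simp_all add: power_divide)
  ultimately show "exp (2 / 5 :: real) \<le> 91 / 60" "exp (3 / 10 :: real) \<le> 49 / 36" by linarith+
qed

text \<open>Applied to the number of vertices with parent in the clique. The Chernoff parameter 2/5
  is close to the optimum \<open>ln (3/2)\<close>, and \<open>31/60 - 3/5 = - 1/12\<close>.\<close>

lemma binomial_upper_tail_half:
  assumes "0 \<le> p" "p \<le> 1" "real n * p = \<mu>"
  shows "measure_pmf.prob (binomial_pmf n p) {k. 3 / 2 * \<mu> \<le> real k} \<le> exp (- \<mu> / 12)"
proof -
  have "\<mu> * (exp (2 / 5) - 1) \<le> \<mu> * (31 / 60)"
    using exp_numeric_bounds(1) assms by (intro mult_left_mono) auto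
  then have "exp (real n * p * (exp (2 / 5) - 1) - 2 / 5 * (3 / 2 * \<mu>)) \<le> exp (- \<mu> / 12)"
    unfolding assms(3) by simp
  then show ?thesis using binomial_chernoff[of p "2 / 5" n "3 / 2 * \<mu>"] assms by linarith
qed

text \<open>Applied to one fibre, of mean at most \<open>3 l / 2\<close>. The parameter 3/10 is
  close to the optimum \<open>ln (4/3)\<close>, and \<open>3/2 * 13/36 - 3/5 = - 7/120\<close>,
  which is below \<open>- 1/18\<close>.\<close>

lemma binomial_upper_tail_third:
  assumes "0 \<le> p" "p \<le> 1" "real n * p \<le> 3 / 2 * \<mu>"
  shows "measure_pmf.prob (binomial_pmf n p) {k. 2 * \<mu> \<le> real k} \<le> exp (- \<mu> / 18)"
proof -
  have "0 \<le> \<mu>" using assms mult_nonneg_nonneg[of "real n" p] by linarith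
  have "real n * p * (exp (3 / 10) - 1) \<le> 3 / 2 * \<mu> * (13 / 36)"
    using exp_numeric_bounds(2) assms \<open>0 \<le> \<mu>\<close>
    by (intro mult_mono[of "real n * p"]) auto
  then have "exp (real n * p * (exp (3 / 10) - 1) - 3 / 10 * (2 * \<mu>)) \<le> exp (- \<mu> / 18)"
    using \<open>0 \<le> \<mu>\<close> by (subst exp_le_cancel_iff) linarith
  then show ?thesis using binomial_chernoff[of p "3 / 10" n "2 * \<mu>"] assms by linarith
qed

text \<open>Cauchy--Schwarz is applied to the part of the mixture carried by the good set \<open>G\<close>: its
  mass defect \<open>\<delta>\<close> costs \<open>2 \<delta>\<close> under the square root, and conditioning on \<open>G\<close> is avoided.\<close>

lemma tv_le_mixture:
  fixes M :: "'a \<Rightarrow> 'b pmf"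
  assumes fin: "finite A" "set_pmf \<Phi> \<subseteq> A" "finite \<Omega>"
    and M: "\<And>\<phi>. \<phi> \<in> A \<Longrightarrow> set_pmf (M \<phi>) \<subseteq> \<Omega>"
    and T: "set_pmf T = \<Omega>"
    and \<delta>: "measure_pmf.prob \<Phi> (- G) \<le> \<delta>"
    and X: "(\<Sum>\<phi>\<in>A \<inter> G. \<Sum>\<phi>'\<in>A \<inter> G. pmf \<Phi> \<phi> * pmf \<Phi> \<phi>' *
              (\<Sum>x\<in>\<Omega>. pmf (M \<phi>) x * pmf (M \<phi>') x / pmf T x)) \<le> X"
  shows "tv_le (bind_pmf \<Phi> M) T (\<delta> / 2 + sqrt (X - 1 + 2 * \<delta>) / 2)"
proof -
  \<comment> \<open>\<open>g\<close> and \<open>b\<close> are the contributions of the good and the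
    bad components to the mixture; \<open>d\<close> is the mass of \<open>b\<close>.\<close>
  define g where "g x = (\<Sum>\<phi>\<in>A \<inter> G. pmf \<Phi> \<phi> * pmf (M \<phi>) x)" for x
  define b where "b x = (\<Sum>\<phi>\<in>A - G. pmf \<Phi> \<phi> * pmf (M \<phi>) x)" for x
  define d where "d = (\<Sum>\<phi>\<in>A - G. pmf \<Phi> \<phi>)"
  have Tpos: "0 < pmf T x" if "x \<in> \<Omega>" for x
    using that T by (simp add: pmf_positive)
  have sumT: "sum (pmf T) \<Omega> = 1" using T fin(3) by (intro sum_pmf_eq_1) auto
  have sumM: "sum (pmf (M \<phi>)) \<Omega> = 1" if "\<phi> \<in> A" for \<phi>
    using M[OF that] fin(3) by (intro sum_pmf_eq_1) auto
  have split: "sum f A = sum f (A \<inter> G) + sum f (A - G)" for f :: "'a \<Rightarrow> real"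
    using fin(1) by (rule sum.Int_Diff)
  have sumA: "(\<Sum>\<phi>\<in>A. pmf \<Phi> \<phi>) = 1" using fin by (intro sum_pmf_eq_1) auto
  have dle: "d \<le> \<delta>"
  proof -
    have "d = measure_pmf.prob \<Phi> (A - G)"
      unfolding d_def using fin by (simp add: measure_measure_pmf_finite)
    also have "\<dots> \<le> measure_pmf.prob \<Phi> (- G)" by (intro measure_pmf.finite_measure_mono) auto
    finally show ?thesis using \<delta> by simp
  qed
  have bind: "pmf (bind_pmf \<Phi> M) x = g x + b x" for x
  proof -
    have "pmf (bind_pmf \<Phi> M) x = (\<Sum>\<phi>\<in>A. pmf (M \<phi>) x * pmf \<Phi> \<phi>)"
      unfolding pmf_bind using fin by (intro integral_measure_pmf_real) auto
    then show ?thesis unfolding g_def b_def split by (simp add: mult.commute)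
  qed
  have sumb: "sum b \<Omega> = d"
    unfolding b_def d_def
    by (subst sum.swap) (auto intro!: sum.cong simp: sumM simp flip: sum_distrib_left)
  have sumg: "sum g \<Omega> = 1 - d"
  proof -
    have "sum g \<Omega> = (\<Sum>\<phi>\<in>A \<inter> G. pmf \<Phi> \<phi>)"
      unfolding g_def
      by (subst sum.swap) (auto intro!: sum.cong simp: sumM simp flip: sum_distrib_left)
    then show ?thesis using sumA split[of "pmf \<Phi>"] unfolding d_def by simp
  qed
  have b0: "0 \<le> b x" for x unfolding b_def by (intro sum_nonneg) auto
  have chi: "(\<Sum>x\<in>\<Omega>. (g x)\<^sup>2 / pmf T x) \<le> X"
  proof -
    have "(\<Sum>x\<in>\<Omega>. (g x)\<^sup>2 / pmf T x)
        = (\<Sum>x\<in>\<Omega>. \<Sum>\<phi>\<in>A \<inter> G. \<Sum>\<phi>'\<in>A \<inter> G. pmf \<Phi> \<phi> * pmf \<Phi> \<phi>' * (pmf (M \<phi>) x * pmf (M \<phi>') x / pmf T x))"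
      unfolding g_def power2_eq_square sum_product sum_divide_distrib
      by (intro sum.cong refl) simp
    also have "\<dots> = (\<Sum>\<phi>\<in>A \<inter> G. \<Sum>\<phi>'\<in>A \<inter> G. pmf \<Phi> \<phi> * pmf \<Phi> \<phi>' *
              (\<Sum>x\<in>\<Omega>. pmf (M \<phi>) x * pmf (M \<phi>') x / pmf T x))"
      unfolding sum_distrib_left
      by (subst sum.swap, intro sum.cong refl, subst sum.swap, simp)
    finally show ?thesis using X by simp
  qed
  \<comment> \<open>Weighting by the square root of \<open>T\<close> and expanding leaves the second
    moment of \<open>g / T\<close> minus twice the mass of \<open>g\<close> plus 1. The mass of
    \<open>g\<close> is \<open>1 - d\<close>, whence the bound
    \<open>X - 1 + 2 * \<delta>\<close>.\<close>
  have "(\<Sum>x\<in>\<Omega>. \<bar>g x - pmf T x\<bar>)\<^sup>2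
      = (\<Sum>x\<in>\<Omega>. sqrt (pmf T x) * (\<bar>g x - pmf T x\<bar> / sqrt (pmf T x)))\<^sup>2"
    using Tpos by (intro arg_cong[where f="\<lambda>x. x\<^sup>2"] sum.cong refl) (simp add: less_imp_neq[symmetric])
  also have "\<dots> \<le> (\<Sum>x\<in>\<Omega>. (sqrt (pmf T x))\<^sup>2) * (\<Sum>x\<in>\<Omega>. (\<bar>g x - pmf T x\<bar> / sqrt (pmf T x))\<^sup>2)"
    by (rule Cauchy_Schwarz_ineq_sum)
  also have "\<dots> = (\<Sum>x\<in>\<Omega>. (g x)\<^sup>2 / pmf T x - 2 * g x + pmf T x)"
    using sumT Tpos
    by (simp add: power_divide) (intro sum.cong refl, simp add: power2_eq_square field_simps less_imp_neq[symmetric])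
  also have "\<dots> = (\<Sum>x\<in>\<Omega>. (g x)\<^sup>2 / pmf T x) - 2 * (1 - d) + 1"
    by (simp add: sum.distrib sum_subtractf sumT sumg flip: sum_distrib_left)
  also have "\<dots> \<le> X - 1 + 2 * \<delta>" using chi dle by simp
  finally have sq: "(\<Sum>x\<in>\<Omega>. \<bar>g x - pmf T x\<bar>) \<le> sqrt (X - 1 + 2 * \<delta>)"
    by (rule real_le_rsqrt)
  have "(\<Sum>x\<in>\<Omega>. \<bar>pmf (bind_pmf \<Phi> M) x - pmf T x\<bar>) \<le> (\<Sum>x\<in>\<Omega>. b x + \<bar>g x - pmf T x\<bar>)"
    unfolding bind by (intro sum_mono) (use b0 in \<open>smt (verit)\<close>)
  also have "\<dots> = d + (\<Sum>x\<in>\<Omega>. \<bar>g x - pmf T x\<bar>)" by (simp add: sum.distrib sumb)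
  also have "\<dots> \<le> 2 * (\<delta> / 2 + sqrt (X - 1 + 2 * \<delta>) / 2)" using dle sq by simp
  finally have le: "(\<Sum>x\<in>\<Omega>. \<bar>pmf (bind_pmf \<Phi> M) x - pmf T x\<bar>) \<le> 2 * (\<delta> / 2 + sqrt (X - 1 + 2 * \<delta>) / 2)" .
  show ?thesis
    using le fin M T by (intro tv_le_of_L1[where A=\<Omega>]) auto
qed

text \<open>The second moment factorizes over the elements of \<open>D\<close>: the sum over
  \<open>F\<close> is the expansion of a product of two-term sums, one term for presence and one for
  absence.\<close>

lemma sum_indep_subset_overlap:
  assumes "finite D" and "\<And>e. e \<in> D \<Longrightarrow> 0 \<le> r e \<and> r e \<le> 1"
    and "\<And>e. e \<in> D \<Longrightarrow> 0 \<le> r' e \<and> r' e \<le> 1" and "\<And>e. e \<in> D \<Longrightarrow> 0 \<le> \<tau> e \<and> \<tau> e \<le> 1"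
  shows "(\<Sum>F\<in>Pow D. pmf (indep_subset D r) F * pmf (indep_subset D r') F / pmf (indep_subset D \<tau>) F)
    = (\<Prod>e\<in>D. r e * r' e / \<tau> e + (1 - r e) * (1 - r' e) / (1 - \<tau> e))"
proof -
  have If: "(\<Prod>e\<in>D. if e \<in> F then x e else y e) = prod x F * prod y (D - F)"
    if "F \<subseteq> D" for F and x y :: "'a \<Rightarrow> real"
    using assms(1) that by (simp add: prod.If_cases Int_absorb1 Diff_eq)
  have "(\<Sum>F\<in>Pow D. pmf (indep_subset D r) F * pmf (indep_subset D r') F / pmf (indep_subset D \<tau>) F)
    = (\<Sum>F\<in>Pow D. (\<Prod>e\<in>F. r e * r' e / \<tau> e) * (\<Prod>e\<in>D - F. (1 - r e) * (1 - r' e) / (1 - \<tau> e)))"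
  proof (intro sum.cong refl)
    fix F assume "F \<in> Pow D"
    then have F: "F \<subseteq> D" by simp
    show "pmf (indep_subset D r) F * pmf (indep_subset D r') F / pmf (indep_subset D \<tau>) F
      = (\<Prod>e\<in>F. r e * r' e / \<tau> e) * (\<Prod>e\<in>D - F. (1 - r e) * (1 - r' e) / (1 - \<tau> e))"
      using assms F by (simp add: pmf_indep_subset If prod.distrib prod_dividef)
  qed
  also have "\<dots> = (\<Prod>e\<in>D. r e * r' e / \<tau> e + (1 - r e) * (1 - r' e) / (1 - \<tau> e))"
    by (rule prod_add[OF assms(1), symmetric])
  finally show ?thesis .
qed

section \<open>Pairs joined by two random partitions\<close>

lemma sum_PiE_dflt_insert:
  assumes "finite W" "finite S" "u \<notin> W"
  shows "sum h (PiE_dflt (insert u W) d (\<lambda>_. S)) = (\<Sum>f\<in>PiE_dflt W d (\<lambda>_. S). \<Sum>y\<in>S. h (f(u := y)))"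
proof -
  let ?A = "PiE_dflt W d (\<lambda>_. S)"
  have inj: "inj_on (\<lambda>(f, y). f(u := y)) (?A \<times> S)"
  proof (rule inj_onI, clarify)
    fix f y f' y' assume f: "f \<in> ?A" "f' \<in> ?A" and eq: "f(u := y) = f'(u := y')"
    have "f v = f' v" for v
      using fun_cong[OF eq, of v] f assms(3) by (cases "v = u") (auto simp: PiE_dflt_def)
    then show "f = f' \<and> y = y'" using fun_cong[OF eq, of u] by auto
  qed
  have im: "(\<lambda>(f, y). f(u := y)) ` (?A \<times> S) = PiE_dflt (insert u W) d (\<lambda>_. S)"
  proof (intro equalityI subsetI)
    fix g assume g: "g \<in> PiE_dflt (insert u W) d (\<lambda>_. S)"
    then have "g(u := d) \<in> ?A" "g u \<in> S" "g = (g(u := d))(u := g u)"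
      using assms(3) by (auto simp: PiE_dflt_def)
    then show "g \<in> (\<lambda>(f, y). f(u := y)) ` (?A \<times> S)"
      by (intro image_eqI[where x="(g(u := d), g u)"]) auto
  qed (use assms(3) in \<open>auto simp: PiE_dflt_def\<close>)
  show ?thesis
    using sum.reindex[OF inj, of h] unfolding im
    by (simp add: sum.cartesian_product case_prod_unfold o_def)
qed

text \<open>Quantifying over the set avoids naming the endpoints of an unordered pair.\<close>

definition same_class :: "('a \<Rightarrow> 'b) \<Rightarrow> 'a set \<Rightarrow> bool" where
  "same_class f e \<longleftrightarrow> (\<forall>u\<in>e. \<forall>v\<in>e. f u = f v)"

definition common_pairs :: "'a set \<Rightarrow> ('a \<Rightarrow> 'b) \<Rightarrow> ('a \<Rightarrow> 'b) \<Rightarrow> 'a set set" where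
  "common_pairs W f f' = {e \<in> [W]\<^bsup>2\<^esup>. same_class f e \<and> same_class f' e}"

text \<open>Old pairs do not contain \<open>u\<close> and are unaffected; a new pair
  \<open>{u, v}\<close> counts exactly when \<open>v\<close> lies in the cell of
  \<open>u\<close>.\<close>

lemma card_common_pairs_insert:
  fixes f f' :: "'a \<Rightarrow> 'b"
  assumes "finite W" "u \<notin> W"
  shows "card (common_pairs (insert u W) (f(u := y)) (f'(u := y')))
    = card (common_pairs W f f') + card {v \<in> W. f v = y \<and> f' v = y'}"
proof -
  let ?R = "{v \<in> W. f v = y \<and> f' v = y'}"
  have mono: "same_class (g(u := z)) e \<longleftrightarrow> same_class g e" if "e \<in> [W]\<^bsup>2\<^esup>" for g :: "'a \<Rightarrow> 'b" and z e
    using that assms(2) by (auto simp: same_class_def nsets_def)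
  have new: "[insert u W]\<^bsup>2\<^esup> = [W]\<^bsup>2\<^esup> \<union> (\<lambda>v. {u, v}) ` W"
    using assms(2) by (auto simp: nsets_2_eq)
  have mono_new: "same_class (g(u := z)) {u, v} \<longleftrightarrow> g v = z" if "v \<in> W" for g :: "'a \<Rightarrow> 'b" and z v
    using that assms(2) by (auto simp: same_class_def)
  have "common_pairs (insert u W) (f(u := y)) (f'(u := y')) = common_pairs W f f' \<union> (\<lambda>v. {u, v}) ` ?R"
    unfolding common_pairs_def new using mono mono_new by auto
  moreover have "common_pairs W f f' \<inter> (\<lambda>v. {u, v}) ` ?R = {}"
    using assms(2) by (auto simp: common_pairs_def)
  moreover have "inj_on (\<lambda>v. {u, v}) ?R" by (auto simp: inj_on_def doubleton_eq_iff)
  moreover have "finite (common_pairs W f f')"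
    using assms(1) by (simp add: common_pairs_def finite_imp_finite_nsets)
  ultimately show ?thesis using assms(1) by (simp add: card_Un_disjoint card_image)
qed

text \<open>Every \<open>v\<close> lies in exactly one cell.\<close>

lemma sum_card_cells:
  assumes "finite W" "finite S" "f ` W \<subseteq> S" "f' ` W \<subseteq> S"
  shows "(\<Sum>y\<in>S. \<Sum>y'\<in>S. real (card {v \<in> W. f v = y \<and> f' v = y'})) = real (card W)"
proof -
  have "(\<Sum>y\<in>S. \<Sum>y'\<in>S. real (card {v \<in> W. f v = y \<and> f' v = y'}))
    = (\<Sum>y\<in>S. \<Sum>y'\<in>S. \<Sum>v\<in>W. if f v = y \<and> f' v = y' then 1 else 0)"
    using assms(1) by (simp add: sum.If_cases Int_def)
  also have "\<dots> = (\<Sum>y\<in>S. \<Sum>v\<in>W. \<Sum>y'\<in>S. if f v = y \<and> f' v = y' then 1 else 0)"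
    by (intro sum.cong refl sum.swap)
  also have "\<dots> = (\<Sum>v\<in>W. \<Sum>y\<in>S. \<Sum>y'\<in>S. if f v = y \<and> f' v = y' then 1 else 0)"
    by (rule sum.swap)
  also have "\<dots> = (\<Sum>v\<in>W. 1)"
  proof (rule sum.cong[OF refl])
    fix v assume v: "v \<in> W"
    have "(\<Sum>y\<in>S. \<Sum>y'\<in>S. if f v = y \<and> f' v = y' then 1 else 0)
      = (\<Sum>y\<in>S. if f v = y then (\<Sum>y'\<in>S. if f' v = y' then 1 else 0 :: real) else 0)"
      by (intro sum.cong refl) auto
    also have "\<dots> = 1" using v assms by (auto simp: sum.delta)
    finally show "(\<Sum>y\<in>S. \<Sum>y'\<in>S. if f v = y \<and> f' v = y' then 1 else 0) = (1::real)" .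
  qed
  finally show ?thesis by simp
qed

definition small_fibres :: "nat \<Rightarrow> 'b set \<Rightarrow> 'a set \<Rightarrow> ('a \<Rightarrow> 'b) \<Rightarrow> bool" where
  "small_fibres L S W f \<longleftrightarrow> (\<forall>s\<in>S. card {v \<in> W. f v = s} \<le> L)"

text \<open>Linearizes the weight of a cell, so that averages over cells become computable. In the
  induction the quadratic term \<open>2 * q * r * q\<close> is at most \<open>q\<close>, because
  \<open>2 * q * L \<le> 1\<close>.\<close>

lemma power_one_plus_le:
  fixes q :: real
  assumes "0 \<le> q" "2 * q * real L \<le> 1" "r \<le> L"
  shows "(1 + q) ^ r \<le> 1 + 2 * q * real r"
  using assms(3)
proof (induction r)
  case (Suc r)
  have "2 * q * real r \<le> 2 * q * real L" using Suc assms by (intro mult_left_mono) auto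
  then have "2 * q * real r \<le> 1" using assms by linarith
  then have "2 * q * real r * q \<le> 1 * q" using assms by (intro mult_right_mono) auto
  moreover have "(1 + q) * (1 + q) ^ r \<le> (1 + q) * (1 + 2 * q * real r)"
    using Suc assms by (intro mult_left_mono) auto
  ultimately show ?case by (simp add: algebra_simps)
qed simp

text \<open>Insert the vertices one at a time. Given two colourings of \<open>W\<close>, a new vertex in cell
  \<open>(y, y')\<close> multiplies the summand by \<open>(1 + q) ^ r \<le> 1 + 2 q r\<close>, where \<open>r\<close> is the size of
  the cell; averaged over the cells this is \<open>1 + 2 q |W| / k\<^sup>2\<close>, whatever the colourings are.\<close>

lemma sum_common_pairs_le:
  fixes q :: real and W :: "'a set" and S :: "'b set"
  assumes W: "finite W" and S: "finite S" "S \<noteq> {}" and q: "0 \<le> q" "2 * q * real L \<le> 1"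
  shows "(\<Sum>f\<in>PiE_dflt W d (\<lambda>_. S). \<Sum>f'\<in>PiE_dflt W d (\<lambda>_. S).
      if small_fibres L S W f \<and> small_fibres L S W f' then (1 + q) ^ card (common_pairs W f f') else 0)
    \<le> real (card S) ^ (2 * card W) * exp (q * real (card W) ^ 2 / real (card S) ^ 2)"
  using W
proof (induction W rule: finite_induct)
  case empty
  have "PiE_dflt ({} :: 'a set) d (\<lambda>_. S) = {\<lambda>_. d}" by (auto simp: PiE_dflt_def)
  then show ?case by (simp add: small_fibres_def common_pairs_def nsets_empty_iff)
next
  case (insert u W)
  let ?A = "PiE_dflt W d (\<lambda>_. S)" and ?k = "real (card S)" and ?w = "real (card W)"
  let ?H = "\<lambda>W f f'. if small_fibres L S W f \<and> small_fibres L S W f'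
    then (1 + q) ^ card (common_pairs W f f') else 0"
  let ?r = "\<lambda>f f' y y'. card {v \<in> W. f v = y \<and> f' v = y'}"
  have k: "?k > 0" using S by (simp add: card_gt_0_iff)
  \<comment> \<open>Removing a vertex only shrinks fibres, so the restriction passes down to
    \<open>W\<close>.\<close>
  have small: "small_fibres L S W f" if "small_fibres L S (insert u W) (f(u := y))" for f y
    unfolding small_fibres_def
  proof
    fix s assume "s \<in> S"
    then have "card {v \<in> insert u W. (f(u := y)) v = s} \<le> L" using that by (auto simp: small_fibres_def)
    moreover have "card {v \<in> W. f v = s} \<le> card {v \<in> insert u W. (f(u := y)) v = s}"
      using insert.hyps by (intro card_mono) auto
    ultimately show "card {v \<in> W. f v = s} \<le> L" by simp
  qed
  have step: "?H (insert u W) (f(u := y)) (f'(u := y')) \<le> ?H W f f' * (1 + 2 * q * real (?r f f' y y'))"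
    if y: "y \<in> S" for f f' y y'
  proof (cases "small_fibres L S (insert u W) (f(u := y)) \<and> small_fibres L S (insert u W) (f'(u := y'))")
    case True
    then have s: "small_fibres L S W f" "small_fibres L S W f'" using small by auto
    \<comment> \<open>A cell is contained in a fibre of \<open>f\<close>, which bounds its size by
      \<open>L\<close>.\<close>
    have "?r f f' y y' \<le> card {v \<in> W. f v = y}" using insert.hyps by (intro card_mono) auto
    then have "?r f f' y y' \<le> L" using s(1) y unfolding small_fibres_def by fastforce
    then have "(1 + q) ^ ?r f f' y y' \<le> 1 + 2 * q * real (?r f f' y y')"
      by (rule power_one_plus_le[OF q])
    then have "(1 + q) ^ card (common_pairs W f f') * (1 + q) ^ ?r f f' y y'
        \<le> (1 + q) ^ card (common_pairs W f f') * (1 + 2 * q * real (?r f f' y y'))"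
      using q by (intro mult_left_mono) auto
    then show ?thesis
      using True s insert.hyps by (simp add: card_common_pairs_insert power_add)
  next
    case False
    then show ?thesis using q by auto
  qed
  have cells: "(\<Sum>y\<in>S. \<Sum>y'\<in>S. 1 + 2 * q * real (?r f f' y y')) = ?k\<^sup>2 + 2 * q * ?w"
    if "f \<in> ?A" "f' \<in> ?A" for f f'
  proof -
    have "f ` W \<subseteq> S" "f' ` W \<subseteq> S" using that by (auto simp: PiE_dflt_def)
    then show ?thesis
      using sum_card_cells[OF insert.hyps(1) S(1), of f f']
      by (simp add: sum.distrib power2_eq_square flip: sum_distrib_left)
  qed
  have "(\<Sum>f\<in>PiE_dflt (insert u W) d (\<lambda>_. S). \<Sum>f'\<in>PiE_dflt (insert u W) d (\<lambda>_. S). ?H (insert u W) f f')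
    = (\<Sum>f\<in>?A. \<Sum>y\<in>S. \<Sum>f'\<in>?A. \<Sum>y'\<in>S. ?H (insert u W) (f(u := y)) (f'(u := y')))"
    unfolding sum_PiE_dflt_insert[OF insert.hyps(1) S(1) insert.hyps(2)] ..
  also have "\<dots> \<le> (\<Sum>f\<in>?A. \<Sum>y\<in>S. \<Sum>f'\<in>?A. \<Sum>y'\<in>S. ?H W f f' * (1 + 2 * q * real (?r f f' y y')))"
    using step by (intro sum_mono) auto
  also have "\<dots> = (\<Sum>f\<in>?A. \<Sum>f'\<in>?A. ?H W f f' * (\<Sum>y\<in>S. \<Sum>y'\<in>S. 1 + 2 * q * real (?r f f' y y')))"
    unfolding sum_distrib_left by (intro sum.cong refl sum.swap)
  also have "\<dots> = (\<Sum>f\<in>?A. \<Sum>f'\<in>?A. ?H W f f' * (?k\<^sup>2 + 2 * q * ?w))"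
    by (intro sum.cong refl) (simp only: cells)
  also have "\<dots> = (\<Sum>f\<in>?A. \<Sum>f'\<in>?A. ?H W f f') * (?k\<^sup>2 + 2 * q * ?w)"
    by (simp only: sum_distrib_right)
  also have "\<dots> \<le> (?k ^ (2 * card W) * exp (q * ?w\<^sup>2 / ?k\<^sup>2)) * (?k\<^sup>2 * exp (2 * q * ?w / ?k\<^sup>2))"
  proof (rule mult_mono)
    have "?k\<^sup>2 + 2 * q * ?w = ?k\<^sup>2 * (1 + 2 * q * ?w / ?k\<^sup>2)" using k by (simp add: field_simps)
    also have "\<dots> \<le> ?k\<^sup>2 * exp (2 * q * ?w / ?k\<^sup>2)"
      by (intro mult_left_mono exp_ge_add_one_self) auto
    finally show "?k\<^sup>2 + 2 * q * ?w \<le> ?k\<^sup>2 * exp (2 * q * ?w / ?k\<^sup>2)" .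
  qed (use insert.IH q in auto)
  also have "\<dots> = ?k ^ (2 * card (insert u W)) * exp (q * ?w\<^sup>2 / ?k\<^sup>2 + 2 * q * ?w / ?k\<^sup>2)"
    using insert.hyps by (simp add: exp_add power2_eq_square)
  \<comment> \<open>The exponents accumulate to a square:
    \<open>w^2 + 2 w \<le> (w + 1)^2\<close>.\<close>
  also have "\<dots> \<le> ?k ^ (2 * card (insert u W)) * exp (q * real (card (insert u W)) ^ 2 / ?k\<^sup>2)"
  proof (intro mult_left_mono)
    have "q * ?w\<^sup>2 + 2 * q * ?w \<le> q * (?w + 1)\<^sup>2" using q by (simp add: power2_eq_square algebra_simps)
    then have "(q * ?w\<^sup>2 + 2 * q * ?w) / ?k\<^sup>2 \<le> q * (?w + 1)\<^sup>2 / ?k\<^sup>2" by (rule divide_right_mono) simp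
    then show "exp (q * ?w\<^sup>2 / ?k\<^sup>2 + 2 * q * ?w / ?k\<^sup>2) \<le> exp (q * real (card (insert u W)) ^ 2 / ?k\<^sup>2)"
      using insert.hyps by (simp add: add_divide_distrib add.commute)
  qed simp
  finally show ?case .
qed

section \<open>The planted model\<close>

lemma map_pmf_of_set_eq_bernoulli:
  assumes "finite S" "s \<in> S"
  shows "map_pmf (\<lambda>x. x = s) (pmf_of_set S) = bernoulli_pmf (1 / real (card S))"
proof -
  have k: "1 \<le> card S" using assms by (metis One_nat_def Suc_leI card_gt_0_iff empty_iff)
  have "pmf (map_pmf (\<lambda>x. x = s) (pmf_of_set S)) True = measure_pmf.prob (pmf_of_set S) {s}"
    by (simp add: pmf_map vimage_def)
  also have "\<dots> = 1 / real (card S)"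
    using assms by (subst measure_pmf_single, subst pmf_of_set) auto
  finally have T: "pmf (map_pmf (\<lambda>x. x = s) (pmf_of_set S)) True = 1 / real (card S)" .
  show ?thesis
  proof (rule pmf_eqI)
    fix i show "pmf (map_pmf (\<lambda>x. x = s) (pmf_of_set S)) i = pmf (bernoulli_pmf (1 / real (card S))) i"
      using T k by (cases i) (auto simp: pmf_False_conv_True)
  qed
qed

lemma map_card_fibre:
  assumes "finite W" "finite S" "s \<in> S"
  shows "map_pmf (\<lambda>\<phi>. card {v \<in> W. \<phi> v = s}) (Pi_pmf W d (\<lambda>_. pmf_of_set S))
    = binomial_pmf (card W) (1 / real (card S))"
proof -
  have k: "1 \<le> card S" using assms by (metis One_nat_def Suc_leI card_gt_0_iff empty_iff)
  \<comment> \<open>The default \<open>d = s\<close> is the image of \<open>d\<close> under the test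
    for \<open>s\<close>, as needed to push that test through the product.\<close>
  have "binomial_pmf (card W) (1 / real (card S))
    = map_pmf (\<lambda>f. card {v \<in> W. f v}) (Pi_pmf W (d = s) (\<lambda>_. bernoulli_pmf (1 / real (card S))))"
    using assms k by (intro binomial_pmf_altdef') auto
  also have "\<dots> = map_pmf (\<lambda>f. card {v \<in> W. f v})
      (Pi_pmf W (d = s) (\<lambda>_. map_pmf (\<lambda>x. x = s) (pmf_of_set S)))"
    using assms by (simp add: map_pmf_of_set_eq_bernoulli)
  also have "\<dots> = map_pmf (\<lambda>\<phi>. card {v \<in> W. \<phi> v = s}) (Pi_pmf W d (\<lambda>_. pmf_of_set S))"
    by (subst Pi_pmf_map[OF assms(1), of "\<lambda>x. x = s" d]) (simp_all add: pmf.map_comp o_def)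
  finally show ?thesis ..
qed

text \<open>Union bound over the fibres; each size is binomial with mean at most
  \<open>3 l / 2\<close>.\<close>

lemma prob_not_small_fibres:
  assumes "finite W" "finite S" "S \<noteq> {}" "real (card W) \<le> 3 / 2 * (real (card S) * real l)"
  shows "measure_pmf.prob (Pi_pmf W d (\<lambda>_. pmf_of_set S)) (- {\<phi>. small_fibres (2 * l) S W \<phi>})
    \<le> real (card S) * exp (- real l / 18)"
proof -
  let ?M = "Pi_pmf W d (\<lambda>_. pmf_of_set S)"
  have k: "0 < card S" using assms by (simp add: card_gt_0_iff)
  have one: "measure_pmf.prob ?M {\<phi>. 2 * real l \<le> real (card {v \<in> W. \<phi> v = s})} \<le> exp (- real l / 18)"
    if "s \<in> S" for s
  proof -
    have "real (card W) * (1 / real (card S)) \<le> 3 / 2 * real l"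
      using assms(4) k by (simp add: field_simps)
    then have "measure_pmf.prob (binomial_pmf (card W) (1 / real (card S))) {k. 2 * real l \<le> real k}
        \<le> exp (- real l / 18)"
      using k by (intro binomial_upper_tail_third) auto
    then show ?thesis
      unfolding map_card_fibre[OF assms(1,2) that, of d, symmetric] by (simp add: vimage_def)
  qed
  have "measure_pmf.prob ?M (- {\<phi>. small_fibres (2 * l) S W \<phi>})
    \<le> measure_pmf.prob ?M (\<Union>s\<in>S. {\<phi>. 2 * real l \<le> real (card {v \<in> W. \<phi> v = s})})"
    by (intro measure_pmf.finite_measure_mono) (auto simp: small_fibres_def not_le)
  also have "\<dots> \<le> (\<Sum>s\<in>S. measure_pmf.prob ?M {\<phi>. 2 * real l \<le> real (card {v \<in> W. \<phi> v = s})})"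
    using assms(2) by (intro measure_pmf.finite_measure_subadditive_finite) auto
  also have "\<dots> \<le> (\<Sum>s\<in>S. exp (- real l / 18))" using one by (rule sum_mono)
  finally show ?thesis by simp
qed

text \<open>Draws a parent in two stages, first whether it lies in \<open>S\<close> and then which
  one it is. The first stage is the Bernoulli variable that generates the planted set of the
  target.\<close>

lemma pmf_of_set_split:
  assumes "finite B" "S \<subseteq> B" "S \<noteq> {}"
  shows "pmf_of_set B = bind_pmf (bernoulli_pmf (real (card S) / real (card B)))
      (\<lambda>b. if b then pmf_of_set S else pmf_of_set (B - S))"
\<comment> \<open>If \<open>S = B\<close>, the second branch would sample from the empty set, but it
  has probability 0.\<close>
proof (cases "S = B")
  case True
  then show ?thesis using assms
    by (simp add: bernoulli_pmf_one bind_return_pmf card_gt_0_iff)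
next
  case False
  have fS: "finite S" using assms finite_subset by blast
  have c: "0 < card S" "card S < card B" "card (B - S) = card B - card S"
    using assms False fS by (auto simp: card_gt_0_iff psubset_card_mono card_Diff_subset)
  have ne: "B \<noteq> {}" "B - S \<noteq> {}" using assms False by auto
  show ?thesis
  proof (rule pmf_eqI)
    fix x
    have "real (card S) / real (card B) * (indicator S x / real (card S))
        + (1 - real (card S) / real (card B)) * (indicator (B - S) x / real (card (B - S)))
        = indicator B x / real (card B)"
      using c assms(2) by (auto simp: indicator_def field_simps of_nat_diff)
    then show "pmf (pmf_of_set B) x = pmf (bind_pmf (bernoulli_pmf (real (card S) / real (card B)))
      (\<lambda>b. if b then pmf_of_set S else pmf_of_set (B - S))) x"
      unfolding pmf_bind using assms ne fS c by (simp add: mult.commute)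
  qed
qed

text \<open>The intermediate law between reduction and target: \<open>P'\<close> is replaced by a
  binomial count, while pairs inside a fibre still have density \<open>q\<close>.\<close>

definition partition_edges :: "nat \<Rightarrow> real \<Rightarrow> nat set \<Rightarrow> (nat \<Rightarrow> nat) \<Rightarrow> graph pmf" where
  "partition_edges N q W \<phi>
    = indep_subset ([{1..N}]\<^bsup>2\<^esup>) (\<lambda>e. if e \<subseteq> W \<and> \<not> same_class \<phi> e then 2 * q else q)"

text \<open>Only the parents on \<open>W\<close> matter, so the average may be taken over these
  alone.\<close>

lemma partition_edges_restrict:
  "partition_edges N q W (\<lambda>v. if v \<in> W then \<phi> v else d) = partition_edges N q W \<phi>"
proof -
  have eq: "same_class (\<lambda>v. if v \<in> W then \<phi> v else d) e = same_class \<phi> e" if "e \<subseteq> W" for e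
    unfolding same_class_def using that by (intro ball_cong refl) (simp add: subset_iff)
  show ?thesis
    unfolding partition_edges_def using eq by (intro indep_subset_cong if_cong refl) blast
qed

lemma small_fibres_restrict:
  "small_fibres L S W (\<lambda>v. if v \<in> W then \<phi> v else d) = small_fibres L S W \<phi>"
  unfolding small_fibres_def by (simp cong: conj_cong)

section \<open>Comparison with the planted dense subgraph for a fixed clique set\<close>

context reduction
begin

text \<open>A pair contributes the factor 1 unless both partition models have density
  \<open>q\<close> where the target has \<open>2 * q\<close>. Those are the common pairs, each with
  factor \<open>?c \<le> 1 + q\<close>.\<close>

lemma overlap_le:
  assumes "W \<subseteq> {1..N}"
  shows "(\<Sum>F\<in>Pow ([{1..N}]\<^bsup>2\<^esup>). pmf (partition_edges N q W \<phi>) F * pmf (partition_edges N q W \<phi>') F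
      / pmf (indep_subset ([{1..N}]\<^bsup>2\<^esup>) (\<lambda>e. if e \<subseteq> W then 2 * q else q)) F)
    \<le> (1 + q) ^ card (common_pairs W \<phi> \<phi>')"
proof -
  let ?D = "[{1..N}]\<^bsup>2\<^esup>"
  let ?c = "q * q / (2 * q) + (1 - q) * (1 - q) / (1 - 2 * q)"
  have fin: "finite ?D" by (simp add: finite_imp_finite_nsets)
  have sub: "common_pairs W \<phi> \<phi>' \<subseteq> ?D"
    using assms by (auto simp: common_pairs_def nsets_def)
  have c: "0 \<le> ?c" "?c \<le> 1 + q"
  proof -
    show "0 \<le> ?c" using q q_le by auto
    \<comment> \<open>After clearing the denominator the claim reduces to
      \<open>2 q^2 \<le> q / 2\<close>.\<close>
    have "q * q \<le> q * (1 / 16)" using q q_le by (intro mult_left_mono) auto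
    then have "0 \<le> q / 2 - 2 * (q * q)" using q by linarith
    also have "\<dots> = (1 + q / 2) * (1 - 2 * q) - (1 - q) * (1 - q)" by (simp add: field_simps)
    finally have "(1 - q) * (1 - q) \<le> (1 + q / 2) * (1 - 2 * q)" by (simp only: diff_ge_0_iff_ge)
    then have "(1 - q) * (1 - q) / (1 - 2 * q) \<le> 1 + q / 2"
      using q_le by (subst pos_divide_le_eq) auto
    then show "?c \<le> 1 + q" using q by simp
  qed
  have "(\<Sum>F\<in>Pow ?D. pmf (partition_edges N q W \<phi>) F * pmf (partition_edges N q W \<phi>') F
      / pmf (indep_subset ?D (\<lambda>e. if e \<subseteq> W then 2 * q else q)) F)
    = (\<Prod>e\<in>?D. if e \<in> common_pairs W \<phi> \<phi>' then ?c else 1)"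
    unfolding partition_edges_def
  proof (subst sum_indep_subset_overlap[OF fin], goal_cases)
    case 4
    \<comment> \<open>In each case one of the two densities equals the target density and cancels;
      the other then sums with its complement to 1.\<close>
    have half: "2 * q * (2 * q) / (2 * q) + (1 - 2 * q) * (1 - 2 * q) / (1 - 2 * q) = 1"
      "2 * q * q / (2 * q) + (1 - 2 * q) * (1 - q) / (1 - 2 * q) = 1"
      "q * (2 * q) / (2 * q) + (1 - q) * (1 - 2 * q) / (1 - 2 * q) = 1"
      "q * q / q + (1 - q) * (1 - q) / (1 - q) = 1"
      using q q_le by auto
    have mem: "e \<in> common_pairs W \<phi> \<phi>' \<longleftrightarrow> e \<subseteq> W \<and> same_class \<phi> e \<and> same_class \<phi>' e" if "e \<in> ?D" for e
      using that by (auto simp: common_pairs_def nsets_def)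
    show ?case
    proof (intro prod.cong refl)
      fix e assume e: "e \<in> ?D"
      show "(if e \<subseteq> W \<and> \<not> same_class \<phi> e then 2 * q else q) * (if e \<subseteq> W \<and> \<not> same_class \<phi>' e then 2 * q else q)
          / (if e \<subseteq> W then 2 * q else q)
        + (1 - (if e \<subseteq> W \<and> \<not> same_class \<phi> e then 2 * q else q)) * (1 - (if e \<subseteq> W \<and> \<not> same_class \<phi>' e then 2 * q else q))
          / (1 - (if e \<subseteq> W then 2 * q else q))
        = (if e \<in> common_pairs W \<phi> \<phi>' then ?c else 1)"
        by (cases "e \<subseteq> W"; cases "same_class \<phi> e"; cases "same_class \<phi>' e")
           (simp_all only: mem[OF e] half if_True if_False simp_thms)
    qed
  qed (use q q_le in auto)
  also have "\<dots> = ?c ^ card (common_pairs W \<phi> \<phi>')"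
    using fin sub by (simp add: prod.If_cases Int_absorb1)
  also have "\<dots> \<le> (1 + q) ^ card (common_pairs W \<phi> \<phi>')"
    using c by (intro power_mono) auto
  finally show ?thesis .
qed

text \<open>Mixture bound over uniform colourings of \<open>W\<close>: each has mass
  \<open>k\<close> to the power \<open>- card W\<close>, which cancels the leading factor of
  \<open>sum_common_pairs_le\<close>.\<close>

lemma tv_le_partition_dense:
  assumes W: "W \<subseteq> {1..N}" "real (card W) \<le> 3 / 2 * (real (card S) * real l)"
    and S: "finite S" "S \<noteq> {}"
  shows "tv_le (bind_pmf (Pi_pmf W 0 (\<lambda>_. pmf_of_set S)) (partition_edges N q W))
      (indep_subset ([{1..N}]\<^bsup>2\<^esup>) (\<lambda>e. if e \<subseteq> W then 2 * q else q))
      (real (card S) * exp (- real l / 18) / 2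
        + sqrt (exp (9 / 4 * q * real l ^ 2) - 1 + 2 * (real (card S) * exp (- real l / 18))) / 2)"
proof (rule tv_le_mixture[where A="PiE_dflt W 0 (\<lambda>_. S)" and \<Omega>="Pow ([{1..N}]\<^bsup>2\<^esup>)"
      and G="{\<phi>. small_fibres (2 * l) S W \<phi>}"])
  let ?D = "[{1..N}]\<^bsup>2\<^esup>" and ?A = "PiE_dflt W 0 (\<lambda>_. S)" and ?G = "{\<phi>. small_fibres (2 * l) S W \<phi>}"
  let ?k = "real (card S)" and ?T = "indep_subset ([{1..N}]\<^bsup>2\<^esup>) (\<lambda>e. if e \<subseteq> W then 2 * q else q)"
  have fW: "finite W" using W(1) finite_subset by blast
  have k: "?k > 0" using S by (simp add: card_gt_0_iff)
  have fD: "finite ?D" by (simp add: finite_imp_finite_nsets)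
  show fA: "finite ?A" using fW S by auto
  have Ane: "?A \<noteq> {}" using S by simp
  have Phi: "Pi_pmf W 0 (\<lambda>_. pmf_of_set S) = pmf_of_set ?A"
    using fW S by (intro Pi_pmf_of_set) auto
  show "set_pmf (Pi_pmf W 0 (\<lambda>_. pmf_of_set S)) \<subseteq> ?A"
    unfolding Phi using fA Ane by simp
  show "finite (Pow ?D)" using fD by simp
  show "set_pmf (partition_edges N q W \<phi>) \<subseteq> Pow ?D" for \<phi>
    unfolding partition_edges_def by (rule set_indep_subset)
  show "set_pmf ?T = Pow ?D"
  proof (rule equalityI[OF set_indep_subset], rule subsetI)
    fix F assume F: "F \<in> Pow ?D"
    have "pmf ?T F = (\<Prod>e\<in>?D. if e \<in> F then if e \<subseteq> W then 2 * q else q else 1 - (if e \<subseteq> W then 2 * q else q))"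
      using fD F q q_le by (intro pmf_indep_subset) auto
    also have "\<dots> > 0" using q q_le by (intro prod_pos) auto
    finally show "F \<in> set_pmf ?T" by (simp add: set_pmf_iff)
  qed
  show "measure_pmf.prob (Pi_pmf W 0 (\<lambda>_. pmf_of_set S)) (- ?G) \<le> ?k * exp (- real l / 18)"
    using fW S W by (intro prob_not_small_fibres) auto
  have cA: "real (card ?A) = ?k ^ card W" using fW S by (simp add: card_PiE_dflt)
  let ?O = "\<lambda>\<phi> \<phi>'. \<Sum>F\<in>Pow ?D. pmf (partition_edges N q W \<phi>) F * pmf (partition_edges N q W \<phi>') F / pmf ?T F"
  let ?H = "\<lambda>\<phi> \<phi>'. if small_fibres (2 * l) S W \<phi> \<and> small_fibres (2 * l) S W \<phi>'
      then (1 + q) ^ card (common_pairs W \<phi> \<phi>') else 0"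
  have pA: "pmf (Pi_pmf W 0 (\<lambda>_. pmf_of_set S)) \<phi> = 1 / ?k ^ card W" if "\<phi> \<in> ?A" for \<phi>
    unfolding Phi using fA Ane that cA by simp
  have "(\<Sum>\<phi>\<in>?A \<inter> ?G. \<Sum>\<phi>'\<in>?A \<inter> ?G. pmf (Pi_pmf W 0 (\<lambda>_. pmf_of_set S)) \<phi>
        * pmf (Pi_pmf W 0 (\<lambda>_. pmf_of_set S)) \<phi>' * ?O \<phi> \<phi>')
    \<le> (\<Sum>\<phi>\<in>?A \<inter> ?G. \<Sum>\<phi>'\<in>?A \<inter> ?G. 1 / ?k ^ (2 * card W) * ?H \<phi> \<phi>')"
  proof (intro sum_mono)
    fix \<phi> \<phi>' assume m: "\<phi> \<in> ?A \<inter> ?G" "\<phi>' \<in> ?A \<inter> ?G"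
    then have "?O \<phi> \<phi>' \<le> ?H \<phi> \<phi>'" using overlap_le[OF W(1), of \<phi> \<phi>'] by simp
    then have "1 / ?k ^ (2 * card W) * ?O \<phi> \<phi>' \<le> 1 / ?k ^ (2 * card W) * ?H \<phi> \<phi>'"
      by (intro mult_left_mono) auto
    then show "pmf (Pi_pmf W 0 (\<lambda>_. pmf_of_set S)) \<phi> * pmf (Pi_pmf W 0 (\<lambda>_. pmf_of_set S)) \<phi>' * ?O \<phi> \<phi>'
        \<le> 1 / ?k ^ (2 * card W) * ?H \<phi> \<phi>'"
      using m by (simp only: pA Int_iff) (simp add: power_add mult_2)
  qed
  also have "\<dots> = 1 / ?k ^ (2 * card W) * (\<Sum>\<phi>\<in>?A \<inter> ?G. \<Sum>\<phi>'\<in>?A \<inter> ?G. ?H \<phi> \<phi>')"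
    by (simp only: sum_distrib_left)
  also have "\<dots> \<le> 1 / ?k ^ (2 * card W) * (\<Sum>\<phi>\<in>?A. \<Sum>\<phi>'\<in>?A. ?H \<phi> \<phi>')"
  proof (intro mult_left_mono)
    have "(\<Sum>\<phi>\<in>?A \<inter> ?G. \<Sum>\<phi>'\<in>?A \<inter> ?G. ?H \<phi> \<phi>') \<le> (\<Sum>\<phi>\<in>?A \<inter> ?G. \<Sum>\<phi>'\<in>?A. ?H \<phi> \<phi>')"
      using fA q by (intro sum_mono sum_mono2) auto
    also have "\<dots> \<le> (\<Sum>\<phi>\<in>?A. \<Sum>\<phi>'\<in>?A. ?H \<phi> \<phi>')"
      using fA q by (intro sum_mono2 sum_nonneg) auto
    finally show "(\<Sum>\<phi>\<in>?A \<inter> ?G. \<Sum>\<phi>'\<in>?A \<inter> ?G. ?H \<phi> \<phi>') \<le> (\<Sum>\<phi>\<in>?A. \<Sum>\<phi>'\<in>?A. ?H \<phi> \<phi>')" .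
  qed simp
  also have "\<dots> \<le> 1 / ?k ^ (2 * card W) * (?k ^ (2 * card W) * exp (q * real (card W) ^ 2 / ?k ^ 2))"
  proof (intro mult_left_mono sum_common_pairs_le fW S)
    \<comment> \<open>The weights are linearized with \<open>L = 2 * l\<close>, for which
      \<open>4 q l \<le> 4 q l^2 \<le> 1/4\<close>.\<close>
    have "real l * 1 \<le> real l * real l" using l1 by (intro mult_left_mono) auto
    then have "q * real l \<le> q * real l ^ 2"
      using q by (intro mult_left_mono) (auto simp: power2_eq_square)
    then show "2 * q * real (2 * l) \<le> 1" using ql by simp
  qed (use q in auto)
  also have "\<dots> = exp (q * real (card W) ^ 2 / ?k ^ 2)" using k by simp
  also have "\<dots> \<le> exp (9 / 4 * q * real l ^ 2)"
  proof -
    \<comment> \<open>The constant 9/4 is the square of the 3/2 in the bound on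
      \<open>card W\<close>.\<close>
    have "real (card W) ^ 2 \<le> (3 / 2 * (?k * real l)) ^ 2" using W(2) by (intro power_mono) auto
    then have "q * real (card W) ^ 2 \<le> q * (3 / 2 * (?k * real l)) ^ 2" using q by (intro mult_left_mono) auto
    also have "\<dots> = 9 / 4 * q * real l ^ 2 * ?k ^ 2" by (simp add: power_mult_distrib power_divide)
    finally show ?thesis using k by (simp add: divide_le_eq)
  qed
  finally show "(\<Sum>\<phi>\<in>?A \<inter> ?G. \<Sum>\<phi>'\<in>?A \<inter> ?G. pmf (Pi_pmf W 0 (\<lambda>_. pmf_of_set S)) \<phi>
        * pmf (Pi_pmf W 0 (\<lambda>_. pmf_of_set S)) \<phi>' * ?O \<phi> \<phi>') \<le> exp (9 / 4 * q * real l ^ 2)" .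
qed

text \<open>Only blocks between fibres of two distinct clique vertices incur an error; every other
  block has density exactly \<open>q\<close> on both sides.\<close>

lemma tv_le_blocks_partition:
  assumes S: "S \<subseteq> {1..n}" and W: "W = {v \<in> {1..N}. \<phi> v \<in> S}"
    and \<phi>: "\<And>v. v \<in> {1..N} \<Longrightarrow> \<phi> v \<in> {1..n}" and small: "small_fibres (2 * l) S W \<phi>"
  shows "tv_le (map_pmf (\<lambda>F. \<Union>i\<in>index_pairs n. F i) (Pi_pmf (index_pairs n) {}
        (block_law l \<gamma> m0 (2 * q) q (fibre N \<phi>) (\<lambda>e. if e \<in> [S]\<^bsup>2\<^esup> then 1 else \<gamma>))))
      (partition_edges N q W \<phi>) (2 * real (card S) ^ 2 * (8 * q * real l ^ 2) ^ (m0 + 1))"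
proof -
  let ?I = "index_pairs n" and ?B = "\<lambda>(s, t). pairs_between (fibre N \<phi> s) (fibre N \<phi> t)"
  let ?r = "\<lambda>e. if e \<in> [S]\<^bsup>2\<^esup> then 1 else \<gamma>"
  let ?\<rho> = "\<lambda>e. if e \<subseteq> W \<and> \<not> same_class \<phi> e then 2 * q else q"
  let ?\<epsilon> = "2 * (8 * q * real l ^ 2) ^ (m0 + 1)"
  have fS: "finite S" using S finite_subset by blast
  have e0: "0 \<le> ?\<epsilon>" using q by simp
  have part: "partition_edges N q W \<phi>
      = map_pmf (\<lambda>F. \<Union>i\<in>?I. F i) (Pi_pmf ?I {} (\<lambda>i. indep_subset (?B i) ?\<rho>))"
  proof -
    have "finite (?B i)" for i by (cases i) (simp add: finite_pairs_between finite_fibre)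
    from indep_subset_UNION[OF finite_index_pairs this disjoint_blocks, of n ?\<rho>]
    show ?thesis
      by (simp only: partition_edges_def UN_blocks[of N \<phi> n, OF \<phi>])
  qed
  \<comment> \<open>The error is allotted to all of \<open>S \<times> S\<close>, including the
    diagonal, so at most \<open>card S ^ 2\<close> errors are summed.\<close>
  have block: "tv_le (block_law l \<gamma> m0 (2 * q) q (fibre N \<phi>) ?r i) (indep_subset (?B i) ?\<rho>)
      (if i \<in> S \<times> S then ?\<epsilon> else 0)" for i
  proof (cases i)
    case (Pair s t)
    have dj: "s \<noteq> t \<Longrightarrow> fibre N \<phi> s \<inter> fibre N \<phi> t = {}" by (auto simp: fibre_def)
    \<comment> \<open>The density is constant on a block: a pair lies in \<open>W\<close> iff both
      its parents are in \<open>S\<close>, and is in one class iff \<open>s = t\<close>.\<close>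
    have cross: "?\<rho> e = (if s \<noteq> t \<and> s \<in> S \<and> t \<in> S then 2 * q else q)" if "e \<in> ?B (s, t)" for e
      using that W by (auto simp: pairs_between_def fibre_def same_class_def)
    have rho: "indep_subset (?B i) ?\<rho>
        = indep_subset (?B i) (\<lambda>_. if s \<noteq> t \<and> s \<in> S \<and> t \<in> S then 2 * q else q)"
      using cross Pair by (intro indep_subset_cong) auto
    show ?thesis
    proof (cases "s \<noteq> t \<and> s \<in> S \<and> t \<in> S")
      case True
      have "fibre N \<phi> u = {v \<in> W. \<phi> v = u}" if "u \<in> S" for u
        using that W by (auto simp: fibre_def)
      then have "card (fibre N \<phi> u) \<le> 2 * l" if "u \<in> S" for u
        using that small by (auto simp: small_fibres_def)
      then have "tv_le (block_law l \<gamma> m0 (2 * q) q (fibre N \<phi>) ?r (s, t))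
          (indep_subset (pairs_between (fibre N \<phi> s) (fibre N \<phi> t)) (\<lambda>_. 2 * q)) ?\<epsilon>"
        using True dj by (intro tv_le_block_law_one finite_fibre) auto
      then show ?thesis unfolding rho using True Pair by simp
    next
      case False
      have "block_law l \<gamma> m0 (2 * q) q (fibre N \<phi>) ?r (s, t)
          = indep_subset (pairs_between (fibre N \<phi> s) (fibre N \<phi> t)) (\<lambda>_. q)"
      proof (cases "s = t")
        case True
        then show ?thesis using block_law_diagonal[OF finite_fibre] by simp
      next
        case ne: False
        then show ?thesis using False dj by (intro block_law_gamma finite_fibre) auto
      qed
      then have "block_law l \<gamma> m0 (2 * q) q (fibre N \<phi>) ?r i = indep_subset (?B i) ?\<rho>"
        unfolding rho using False Pair by auto
      then show ?thesis using e0 by (simp add: tv_le_refl)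
    qed
  qed
  have "(\<Sum>i\<in>?I. if i \<in> S \<times> S then ?\<epsilon> else 0) = (\<Sum>i\<in>?I \<inter> S \<times> S. ?\<epsilon>)"
    using finite_index_pairs by (rule sum.inter_restrict[symmetric])
  also have "\<dots> \<le> (\<Sum>i\<in>S \<times> S. ?\<epsilon>)"
    using fS e0 by (intro sum_mono2) auto
  also have "\<dots> = 2 * real (card S) ^ 2 * (8 * q * real l ^ 2) ^ (m0 + 1)"
    by (simp add: card_cartesian_product power2_eq_square)
  finally have sum: "(\<Sum>i\<in>?I. if i \<in> S \<times> S then ?\<epsilon> else 0)
      \<le> 2 * real (card S) ^ 2 * (8 * q * real l ^ 2) ^ (m0 + 1)" .
  show ?thesis
    unfolding part using block sum
    by (intro tv_le_map tv_le_mono[OF tv_le_Pi_pmf[OF finite_index_pairs]]) auto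
qed

text \<open>First pass to the mixture of \<open>partition_edges\<close>, off the event of a large
  fibre of probability at most \<delta>; then merge the fibres by the second moment bound. The
  premise on \<open>S = {1..n}\<close> excludes sampling from an empty complement.\<close>

lemma tv_le_fixed_clique_set:
  assumes S: "S \<subseteq> {1..n}" "card S = k" "1 \<le> k" and Sc: "S = {1..n} \<Longrightarrow> W = {1..N}"
    and W: "W \<subseteq> {1..N}" "real (card W) \<le> 3 / 2 * (real k * real l)"
  defines "\<delta> \<equiv> real k * exp (- real l / 18)"
  shows "tv_le
    (bind_pmf (Pi_pmf {1..N} 0 (\<lambda>v. if v \<in> W then pmf_of_set S else pmf_of_set ({1..n} - S)))
      (\<lambda>\<phi>. map_pmf (\<lambda>F. \<Union>i\<in>index_pairs n. F i) (Pi_pmf (index_pairs n) {}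
        (block_law l \<gamma> m0 (2 * q) q (fibre N \<phi>) (\<lambda>e. if e \<in> [S]\<^bsup>2\<^esup> then 1 else \<gamma>)))))
    (indep_subset ([{1..N}]\<^bsup>2\<^esup>) (\<lambda>e. if e \<subseteq> W then 2 * q else q))
    (\<delta> + 2 * real k ^ 2 * (8 * q * real l ^ 2) ^ (m0 + 1)
      + (\<delta> / 2 + sqrt (exp (9 / 4 * q * real l ^ 2) - 1 + 2 * \<delta>) / 2))"
proof (rule tv_le_trans)
  let ?M = "Pi_pmf {1..N} 0 (\<lambda>v. if v \<in> W then pmf_of_set S else pmf_of_set ({1..n} - S))"
  let ?U = "Pi_pmf W 0 (\<lambda>_. pmf_of_set S)"
  let ?small = "{\<phi>. small_fibres (2 * l) S W \<phi>}"
  have fW: "finite W" using W(1) finite_subset by blast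
  have fS: "finite S" "S \<noteq> {}" using S finite_subset by auto
  have U: "?U = map_pmf (\<lambda>f v. if v \<in> W then f v else 0) ?M"
    using W(1) by (subst Pi_pmf_subset[symmetric]) (auto intro!: Pi_pmf_cong)
  have supp: "\<phi> v \<in> {1..n} \<and> (\<phi> v \<in> S \<longleftrightarrow> v \<in> W)" if "\<phi> \<in> set_pmf ?M" "v \<in> {1..N}" for \<phi> v
  proof -
    have m: "\<phi> v \<in> set_pmf (if v \<in> W then pmf_of_set S else pmf_of_set ({1..n} - S))"
      using that by (auto simp: set_Pi_pmf PiE_dflt_def)
    show ?thesis
    proof (cases "v \<in> W")
      case True
      then show ?thesis using m fS S by auto
    next
      case False
      then have "{1..n} - S \<noteq> {}" using Sc that S(1) by blast
      then show ?thesis using m False by auto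
    qed
  qed
  have "measure_pmf.prob ?M (- ?small) = measure_pmf.prob ?U (- ?small)"
    unfolding U by (simp add: vimage_def small_fibres_restrict Compl_eq)
  also have "\<dots> \<le> \<delta>"
    unfolding \<delta>_def using prob_not_small_fibres[OF fW fS, of l 0] W(2) S(2) by simp
  finally have prob: "measure_pmf.prob ?M (- ?small) \<le> \<delta>" .
  have "tv_le (bind_pmf ?M (\<lambda>\<phi>. map_pmf (\<lambda>F. \<Union>i\<in>index_pairs n. F i) (Pi_pmf (index_pairs n) {}
        (block_law l \<gamma> m0 (2 * q) q (fibre N \<phi>) (\<lambda>e. if e \<in> [S]\<^bsup>2\<^esup> then 1 else \<gamma>)))))
      (bind_pmf ?M (partition_edges N q W))
      (measure_pmf.prob ?M (- ?small) + 2 * real k ^ 2 * (8 * q * real l ^ 2) ^ (m0 + 1))"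
  proof (rule tv_le_bind)
    fix \<phi> assume \<phi>: "\<phi> \<in> set_pmf ?M" "\<phi> \<notin> - ?small"
    have "W = {v \<in> {1..N}. \<phi> v \<in> S}" using supp[OF \<phi>(1)] W(1) by blast
    then show "tv_le (map_pmf (\<lambda>F. \<Union>i\<in>index_pairs n. F i) (Pi_pmf (index_pairs n) {}
        (block_law l \<gamma> m0 (2 * q) q (fibre N \<phi>) (\<lambda>e. if e \<in> [S]\<^bsup>2\<^esup> then 1 else \<gamma>))))
        (partition_edges N q W \<phi>) (2 * real k ^ 2 * (8 * q * real l ^ 2) ^ (m0 + 1))"
      using tv_le_blocks_partition[OF S(1), of W N \<phi>] supp[OF \<phi>(1)] \<phi>(2) S(2) by simp
  qed (use q in auto)
  then show "tv_le (bind_pmf ?M (\<lambda>\<phi>. map_pmf (\<lambda>F. \<Union>i\<in>index_pairs n. F i) (Pi_pmf (index_pairs n) {}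
        (block_law l \<gamma> m0 (2 * q) q (fibre N \<phi>) (\<lambda>e. if e \<in> [S]\<^bsup>2\<^esup> then 1 else \<gamma>)))))
      (bind_pmf ?M (partition_edges N q W))
      (\<delta> + 2 * real k ^ 2 * (8 * q * real l ^ 2) ^ (m0 + 1))"
    using prob by (elim tv_le_mono) simp
  have "bind_pmf ?M (partition_edges N q W) = bind_pmf ?U (partition_edges N q W)"
    unfolding U bind_map_pmf by (simp only: partition_edges_restrict o_def)
  then show "tv_le (bind_pmf ?M (partition_edges N q W))
      (indep_subset ([{1..N}]\<^bsup>2\<^esup>) (\<lambda>e. if e \<subseteq> W then 2 * q else q))
      (\<delta> / 2 + sqrt (exp (9 / 4 * q * real l ^ 2) - 1 + 2 * \<delta>) / 2)"
    unfolding \<delta>_def using tv_le_partition_dense[OF W(1) _ fS] W(2) S(2) by simp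
qed

text \<open>The set of vertices with parent in \<open>S\<close> has independent memberships of
  probability \<open>k / n = K / N\<close>, like the planted set of the target. Hence the two are
  coupled to be equal, and the comparison is made given this set, off the event that it is too
  large.\<close>

lemma tv_le_planted:
  assumes n: "1 \<le> n" and S: "S \<subseteq> {1..n}" "card S = k" "1 \<le> k"
    and N: "N = l * n" and K: "K = k * l"
  defines "\<delta> \<equiv> real k * exp (- real l / 18)"
  shows "tv_le
    (bind_pmf (indep_subset ([{1..n}]\<^bsup>2\<^esup>) (\<lambda>e. if e \<in> [S]\<^bsup>2\<^esup> then 1 else \<gamma>))
      (clique_reduction n N l \<gamma> m0 (2 * q) q))
    (planted_dense_subgraph N K (2 * q) q)
    (exp (- real K / 12) + (\<delta> + 2 * real k ^ 2 * (8 * q * real l ^ 2) ^ (m0 + 1)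
      + (\<delta> / 2 + sqrt (exp (9 / 4 * q * real l ^ 2) - 1 + 2 * \<delta>) / 2)))"
    (is "tv_le _ _ (_ + ?\<epsilon>)")
proof -
  let ?X = "Pi_pmf {1..N} False (\<lambda>_. bernoulli_pmf (real k / real n))"
  let ?W = "\<lambda>x. {v \<in> {1..N}. x v}"
  let ?bad = "{x. 3 / 2 * real K \<le> real (card (?W x))}"
  let ?K = "\<lambda>\<phi>. map_pmf (\<lambda>F. \<Union>i\<in>index_pairs n. F i) (Pi_pmf (index_pairs n) {}
        (block_law l \<gamma> m0 (2 * q) q (fibre N \<phi>) (\<lambda>e. if e \<in> [S]\<^bsup>2\<^esup> then 1 else \<gamma>)))"
  have fS: "finite S" "S \<noteq> {}" using S finite_subset by auto
  have kn: "k \<le> n" using card_mono[OF _ S(1)] S(2) by simp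
  have KN: "real K / real N = real k / real n" using l1 n by (simp add: N K)
  have "pmf_of_set {1..n} = bind_pmf (bernoulli_pmf (real k / real n))
      (\<lambda>b. if b then pmf_of_set S else pmf_of_set ({1..n} - S))"
    using pmf_of_set_split[OF _ S(1) fS(2)] S(2) by simp
  then have parent: "Pi_pmf {1..N} 0 (\<lambda>_. pmf_of_set {1..n})
      = bind_pmf ?X (\<lambda>x. Pi_pmf {1..N} 0 (\<lambda>v. if x v then pmf_of_set S else pmf_of_set ({1..n} - S)))"
    using Pi_pmf_bind[of "{1..N}" "0::nat" "\<lambda>_. bernoulli_pmf (real k / real n)"
        "\<lambda>_ b. if b then pmf_of_set S else pmf_of_set ({1..n} - S)" False] by simp
  have law: "bind_pmf (indep_subset ([{1..n}]\<^bsup>2\<^esup>) (\<lambda>e. if e \<in> [S]\<^bsup>2\<^esup> then 1 else \<gamma>))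
      (clique_reduction n N l \<gamma> m0 (2 * q) q)
    = bind_pmf ?X (\<lambda>x. bind_pmf
        (Pi_pmf {1..N} 0 (\<lambda>v. if v \<in> ?W x then pmf_of_set S else pmf_of_set ({1..n} - S))) ?K)"
    unfolding bind_clique_reduction parent bind_assoc_pmf
    by (intro bind_pmf_cong refl Pi_pmf_cong) auto
  have target: "planted_dense_subgraph N K (2 * q) q
    = bind_pmf ?X (\<lambda>x. indep_subset ([{1..N}]\<^bsup>2\<^esup>) (\<lambda>e. if e \<subseteq> ?W x then 2 * q else q))"
    unfolding planted_dense_subgraph_def KN Let_def indep_edges_pmf_eq ..
  have d0: "0 \<le> \<delta>" unfolding \<delta>_def by simp
  have eps: "0 \<le> ?\<epsilon>" using d0 q by simp
  have bad: "measure_pmf.prob ?X ?bad \<le> exp (- real K / 12)"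
  proof -
    have "binomial_pmf N (real k / real n) = map_pmf (\<lambda>x. card (?W x)) ?X"
      using kn n by (intro binomial_pmf_altdef') auto
    moreover have "measure_pmf.prob (binomial_pmf N (real k / real n)) {j. 3 / 2 * real K \<le> real j}
        \<le> exp (- real K / 12)"
      using kn n by (intro binomial_upper_tail_half) (auto simp: N K)
    ultimately show ?thesis by (simp add: vimage_def)
  qed
  have "tv_le (bind_pmf ?X (\<lambda>x. bind_pmf
        (Pi_pmf {1..N} 0 (\<lambda>v. if v \<in> ?W x then pmf_of_set S else pmf_of_set ({1..n} - S))) ?K))
      (bind_pmf ?X (\<lambda>x. indep_subset ([{1..N}]\<^bsup>2\<^esup>) (\<lambda>e. if e \<subseteq> ?W x then 2 * q else q)))
      (measure_pmf.prob ?X ?bad + ?\<epsilon>)"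
  proof (rule tv_le_bind[OF _ eps])
    fix x assume x: "x \<in> set_pmf ?X" "x \<notin> ?bad"
    have all: "?W x = {1..N}" if "S = {1..n}"
    proof -
      have "real k / real n = 1" using that S(2) n by simp
      then have "x v" if "v \<in> {1..N}" for v
        using x(1) that by (auto simp: set_Pi_pmf PiE_dflt_def bernoulli_pmf_one)
      then show ?thesis by auto
    qed
    show "tv_le (bind_pmf
        (Pi_pmf {1..N} 0 (\<lambda>v. if v \<in> ?W x then pmf_of_set S else pmf_of_set ({1..n} - S))) ?K)
      (indep_subset ([{1..N}]\<^bsup>2\<^esup>) (\<lambda>e. if e \<subseteq> ?W x then 2 * q else q)) ?\<epsilon>"
      unfolding \<delta>_def using x(2) all S by (intro tv_le_fixed_clique_set) (auto simp: K)
  qed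
  then show ?thesis unfolding law target using bad by (elim tv_le_mono) simp
qed

end

theorem proposition3:
  fixes l n k N K m0 :: nat and \<gamma> p q :: real
  assumes "1 \<le> l" and "1 \<le> n" and "k \<in> {1..n}" and "\<gamma> \<in> {0<..1/2}"
    and "N = l * n" and "K = k * l" and "0 < q" and "p = 2 * q"
    and "m0 = nat \<lfloor>log 2 (1 / \<gamma>)\<rfloor>"
    and "16 * q * real l ^ 2 \<le> 1" and "real k \<ge> 6 * exp 1 * real l"
  shows
    "bind_pmf (erdos_renyi n \<gamma>) (clique_reduction n N l \<gamma> m0 p q) = erdos_renyi N q \<and>
     total_variation
         (bind_pmf (planted_clique n k \<gamma>) (clique_reduction n N l \<gamma> m0 p q))
         (planted_dense_subgraph N K p q)
       \<le> exp (- real K / 12) + 1.5 * real k * exp (- real l / 18)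
         + 2 * real k ^ 2 * (8 * q * real l ^ 2) ^ (m0 + 1)
         + 0.5 * sqrt (exp (72 * exp 1 ^ 2 * q * real l ^ 2) - 1)
         + sqrt (0.5 * real k) * exp (- real l / 36)"
proof -
  interpret reduction l m0 \<gamma> q
    using assms by unfold_locales auto
  let ?D = "[{1..n}]\<^bsup>2\<^esup>"
  define \<delta> where "\<delta> = real k * exp (- real l / 18)"
  define \<epsilon> where "\<epsilon> = exp (- real K / 12) + (\<delta> + 2 * real k ^ 2 * (8 * q * real l ^ 2) ^ (m0 + 1)
      + (\<delta> / 2 + sqrt (exp (9 / 4 * q * real l ^ 2) - 1 + 2 * \<delta>) / 2))"
  have k: "1 \<le> k" "k \<le> n" using assms(3) by auto
  have ne: "[{1..n}]\<^bsup>k\<^esup> \<noteq> {}" "finite ([{1..n}]\<^bsup>k\<^esup>)"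
    using k by (auto simp: nsets_eq_empty_iff finite_imp_finite_nsets)
  \<comment> \<open>The clique set is independent of the base graph and may be drawn first. The
    target does not depend on it, so a bound uniform in the clique set survives the average.\<close>
  have clique: "bind_pmf (planted_clique n k \<gamma>) (clique_reduction n N l \<gamma> m0 p q)
    = bind_pmf (pmf_of_set ([{1..n}]\<^bsup>k\<^esup>)) (\<lambda>S. bind_pmf
        (map_pmf (\<lambda>G. G \<union> [S]\<^bsup>2\<^esup>) (indep_subset ?D (\<lambda>_. \<gamma>))) (clique_reduction n N l \<gamma> m0 p q))"
    unfolding planted_clique_def erdos_renyi_def indep_edges_pmf_eq map_pmf_def
    by (subst bind_commute_pmf) (simp add: bind_assoc_pmf)
  have "tv_le (bind_pmf (planted_clique n k \<gamma>) (clique_reduction n N l \<gamma> m0 p q))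
      (bind_pmf (pmf_of_set ([{1..n}]\<^bsup>k\<^esup>)) (\<lambda>_. planted_dense_subgraph N K p q)) \<epsilon>"
    unfolding clique
  proof (rule tv_le_bind_const)
    fix S assume "S \<in> set_pmf (pmf_of_set ([{1..n}]\<^bsup>k\<^esup>))"
    then have S: "S \<subseteq> {1..n}" "card S = k" using ne by (auto simp: nsets_def)
    have "map_pmf (\<lambda>G. G \<union> [S]\<^bsup>2\<^esup>) (indep_subset ?D (\<lambda>_. \<gamma>))
        = indep_subset ?D (\<lambda>e. if e \<in> [S]\<^bsup>2\<^esup> then 1 else \<gamma>)"
      using S by (intro map_Un_indep_subset nsets_mono) (auto simp: finite_imp_finite_nsets)
    then show "tv_le (bind_pmf (map_pmf (\<lambda>G. G \<union> [S]\<^bsup>2\<^esup>) (indep_subset ?D (\<lambda>_. \<gamma>)))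
        (clique_reduction n N l \<gamma> m0 p q)) (planted_dense_subgraph N K p q) \<epsilon>"
      unfolding \<epsilon>_def \<delta>_def using tv_le_planted[OF assms(2) S k(1) assms(5,6)] assms(8) by simp
  qed
  then have "total_variation (bind_pmf (planted_clique n k \<gamma>) (clique_reduction n N l \<gamma> m0 p q))
      (planted_dense_subgraph N K p q) \<le> \<epsilon>"
    by (intro total_variation_le) simp
  also have "\<epsilon> \<le> exp (- real K / 12) + 1.5 * real k * exp (- real l / 18)
         + 2 * real k ^ 2 * (8 * q * real l ^ 2) ^ (m0 + 1)
         + 0.5 * sqrt (exp (72 * exp 1 ^ 2 * q * real l ^ 2) - 1)
         + sqrt (0.5 * real k) * exp (- real l / 36)"
  proof -
    have "9 / 4 * (q * real l ^ 2) \<le> 72 * exp 1 ^ 2 * (q * real l ^ 2)"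
    proof (rule mult_right_mono)
      have "(1::real) ^ 2 \<le> exp 1 ^ 2" by (intro power_mono) auto
      then show "9 / 4 \<le> 72 * exp (1::real) ^ 2" unfolding power_one by linarith
    qed (use q in auto)
    then have "exp (9 / 4 * q * real l ^ 2) \<le> exp (72 * exp 1 ^ 2 * q * real l ^ 2)"
      by (simp only: exp_le_cancel_iff mult.assoc)
    then have 1: "sqrt (exp (9 / 4 * q * real l ^ 2) - 1) \<le> sqrt (exp (72 * exp 1 ^ 2 * q * real l ^ 2) - 1)"
      by simp
    have d0: "0 \<le> \<delta>" unfolding \<delta>_def by simp
    have 2: "sqrt (exp (9 / 4 * q * real l ^ 2) - 1 + 2 * \<delta>)
        \<le> sqrt (exp (9 / 4 * q * real l ^ 2) - 1) + sqrt (2 * \<delta>)"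
      using d0 q by (intro sqrt_add_le_add_sqrt) auto
    \<comment> \<open>Subadditivity of the square root splits off
      \<open>sqrt (2 * \<delta>) / 2\<close>, which equals the last term of the claim; the two
      remaining shares \<delta> and \<open>\<delta> / 2\<close> make the factor 1.5.\<close>
    have "exp (- real l / 18) = (exp (- real l / 36))\<^sup>2"
      by (simp flip: exp_double)
    then have "2 * \<delta> = 2\<^sup>2 * (0.5 * real k) * (exp (- real l / 36))\<^sup>2" unfolding \<delta>_def by simp
    then have 3: "sqrt (2 * \<delta>) = 2 * sqrt (0.5 * real k) * exp (- real l / 36)"
      by (simp only: real_sqrt_mult) simp
    have "sqrt (exp (9 / 4 * q * real l ^ 2) - 1 + 2 * \<delta>) / 2
        \<le> 0.5 * sqrt (exp (72 * exp 1 ^ 2 * q * real l ^ 2) - 1) + sqrt (0.5 * real k) * exp (- real l / 36)"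
      using 1 2 unfolding 3 by linarith
    then show ?thesis unfolding \<epsilon>_def \<delta>_def by simp
  qed
  finally show ?thesis using erdos_renyi_reduction[OF assms(2), of N] assms(8) by simp
qed

end
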